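(* Given a hexagon $[\mathsf c_1,\mathsf c_{12},\mathsf c_2,\mathsf c_{23},\mathsf c_3,\mathsf c_{13}]$ of cyclically touching oriented circles in the plane and one of the two circles $\mathsf c$ which touch the triple of circles $\mathsf c_1,\mathsf c_2,\mathsf c_3$, denote by $\mathsf c^{lm}$, $l\neq m$, the circle passing through the points of contact $p^l,p^m,p^l_m,p^m_l$ (in the Möbius geometric sense) of the quadrilateral of circles $[\mathsf c,\mathsf c_l,\mathsf c_{lm},\mathsf c_m]$. The circles $\mathsf c^{lm}$ and $\mathsf c^{nm}$ intersect in the additional point $p^{(m)}$ for distinct $l,m,n$. There exist circles $\mathsf c^{lm}_n$ which pass through the two points of contact $p^l_n,p^m_n$ of the circles $\mathsf c_n,\mathsf c_{ln},\mathsf c_{mn}$ and the points $p^{(l)},p^{(m)}$. The circles $\mathsf c^{lm}_n,\mathsf c^{ln}_m$ and $\mathsf c_{mn}$ meet in a point $p^l_{mn}$. Then, the (appropriately oriented) circle $\mathsf c_{123}$ passing through the points $p^1_{23},p^2_{13}$ and $p^3_{12}$ touches the triple of circles $\mathsf c_{12},\mathsf c_{23},\mathsf c_{13}$, is well-defined in a Lie geometric sense and is correlated to the circle $\mathsf c$.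
   Context: Indices $l,m,n$ range over $\{1,2,3\}$; lower indices are unordered ($\mathsf c_{lm}=\mathsf c_{ml}$), and $\mathsf c^{lm}=\mathsf c^{ml}$, $\mathsf c^{lm}_n=\mathsf c^{ml}_n$, $p^l_{mn}=p^l_{nm}$. The eight circles $\mathsf c,\mathsf c_l,\mathsf c_{lm},\mathsf c_{123}$ are attached to the vertices of a combinatorial cube. $p^l$ is the point of contact of $\mathsf c$ and $\mathsf c_l$; $p^l_m$ is the point of contact of $\mathsf c_m$ and $\mathsf c_{lm}$. The additional point $p^{(m)}$ is the intersection of $\mathsf c^{lm}$ and $\mathsf c^{nm}$ other than the common point $p^m$. "Touching" always means oriented contact. A quadrilateral of circles is a quadruple of cyclically touching oriented circles; its four points of contact are concyclic. The circles $\mathsf c^{lm}$, $\mathsf c^{lm}_n$ are auxiliary, non-oriented circles of the plane. Oriented circles and lines of a linear line complex: oriented circles of the plane (including points, regarded as circles of zero radius, oriented lines and the point at infinity) are the points $[V]$, $V=(x,y,a,b,r)$, of the Lie quadric $\langle V,V\rangle=0$ in $\mathbb{RP}^4$, with $\langle V,V'\rangle=xx'+yy'-\tfrac12(ab'+a'b)-rr'$: $(x,y,1,x^2+y^2-r^2,r)$ is the circle of centre $(x,y)$ and signed radius $r$, $(v,w,0,2d,1)$ with $v^2+w^2=1$ an oriented line, $(0,0,0,1,0)$ the point at infinity. Two of them touch iff $\langle V,V'\rangle=0$. With Plücker coordinates $\gamma^{\mu\nu}=\alpha^\mu\beta^\nu-\alpha^\nu\beta^\mu$ of the line in $\mathbb{RP}^3$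 through points $\alpha,\beta$, the lines of the linear line complex $\mathcal L=\{\gamma^{03}=\gamma^{12}\}$ are the points $(\gamma^{01},\gamma^{23},\gamma^{02},\gamma^{13},\gamma^{03})$ of the quadric $2\gamma^{01}\gamma^{23}-2\gamma^{02}\gamma^{13}+2(\gamma^{03})^2=0$ of signature $(3,2)$; a fixed linear isometry identifies it with the Lie quadric, so that lines of $\mathcal L$ correspond to oriented circles and intersecting lines to touching circles. Contact elements and turbines: the lines of $\mathcal L$ through a given point of $\mathbb{RP}^3$ correspond to a pencil of mutually touching oriented circles, called a contact element; it is "located" at the point (circle of zero radius) which it contains. The one-parameter family of contact elements corresponding to the points of a given line of $\mathbb{RP}^3$ is called a turbine; two contact elements generate the turbine corresponding to the line through the two corresponding points. If the line does not belong to $\mathcal L$, the contact elements of the turbine are located on a circle of the plane, which represents the turbine. Lie geometric sense of the construction: $\mathcal C^l$ and $\mathcal C^l_m$ denote the contact elements generated by the touching circles $\mathsf c,\mathsf c_l$ and $\mathsf c_m,\mathsf c_{lm}$ respectively, and $\mathcal T^{l,m}$ the turbine generated by $\mathcal C^l$ and $\mathcal C^l_m$. The auxiliary circle $\mathsf c^{lm}$ represents the turbines $\mathcal T^{l,m}$ and $\mathcal T^{m,l}$; $p^{(m)}$ is the location of the contact element $\mathcal C^{(m)}$ shared by $\mathcal T^{l,m}$ and $\mathcal T^{n,m}$; $\mathsf c^{lm}_n$ represents the turbine $\mathcal T^{l,m}_n$ generated by $\mathcal C^l_n,\mathcal C^{(m)}$ and the turbine $\mathcal T^{m,l}_n$ generated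 by $\mathcal C^m_n,\mathcal C^{(l)}$; $p^l_{mn}$ is the location of the contact element $\mathcal C^l_{mn}$ shared by $\mathcal T^{l,m}_n$ and $\mathcal T^{l,n}_m$, which contains the circle $\mathsf c_{mn}$. The oriented circle $\mathsf c_{123}$ is the unique one contained in the contact elements $\mathcal C^1_{23},\mathcal C^2_{13},\mathcal C^3_{12}$. Correlated circles: a hexagon with vertices $x^1,\dots,x^6$ (indices mod 6) in general position in $\mathbb{RP}^3$ has a unique associated correlation $\kappa(x)=\{y:y^TBx=0\}$, $B=B^T$, with $\kappa(x^i)=\pi^{i+3}$, where $\pi^i$ is the plane spanned by $x^{i-1},x^i,x^{i+1}$; the image of a line is the intersection of the images of its points. Two opposite circles of a combinatorial cube of eight oriented circles which touch along edges are correlated if the corresponding lines of $\mathcal L$ are images of each other under the correlation associated with the hexagon formed by the lines corresponding to the remaining six circles. Here, this hexagon is formed by the lines corresponding to $\mathsf c_1,\mathsf c_{12},\mathsf c_2,\mathsf c_{23},\mathsf c_3,\mathsf c_{13}$ and is taken to be in general position, and the position of the circles is assumed to be such that the Apollonius problems of finding oriented circles touching $\mathsf c_1,\mathsf c_2,\mathsf c_3$ and $\mathsf c_{12},\mathsf c_{23},\mathsf c_{13}$ are solvable. *)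

theory Defs
  imports "HOL-Analysis.Analysis"
begin

section \<open>Oriented circles: the Lie quadric\<close>

text \<open>A tuple (x, y, a, b, r) holds homogeneous coordinates.  The circle of centre (x, y) and signed
  radius r is (x, y, 1, x^2 + y^2 - r^2, r), an oriented line with unit normal (v, w) is
  (v, w, 0, 2 d, 1), the point at infinity is (0, 0, 0, 1, 0).  Points are circles with r = 0.\<close>

type_synonym lvec = "real \<times> real \<times> real \<times> real \<times> real"

fun lie_form :: "lvec \<Rightarrow> lvec \<Rightarrow> real" where
  "lie_form (x, y, a, b, r) (x', y', a', b', r') =
     x * x' + y * y' - (a * b' + a' * b) / 2 - r * r'"

definition oriented_circle :: "lvec \<Rightarrow> bool" where
  "oriented_circle V \<longleftrightarrow> V \<noteq> 0 \<and> lie_form V V = 0"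

definition same_circle :: "lvec \<Rightarrow> lvec \<Rightarrow> bool" where
  "same_circle V V' \<longleftrightarrow> (\<exists>k. k \<noteq> 0 \<and> V' = k *\<^sub>R V)"

definition touch :: "lvec \<Rightarrow> lvec \<Rightarrow> bool" where
  "touch V V' \<longleftrightarrow> lie_form V V' = 0"

definition lie_transformation :: "(lvec \<Rightarrow> lvec) \<Rightarrow> bool" where
  "lie_transformation T \<longleftrightarrow> linear T \<and> (\<forall>V V'. lie_form (T V) (T V') = lie_form V V')"

section \<open>Points and non-oriented circles of the plane\<close>

text \<open>Points of the plane extended by the point at infinity, which is None.\<close>

type_synonym mpoint = "(real \<times> real) option"

fun point_circle :: "mpoint \<Rightarrow> lvec" where
  "point_circle (Some (x, y)) = (x, y, 1, x\<^sup>2 + y\<^sup>2, 0)"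
| "point_circle None = (0, 0, 0, 1, 0)"

definition points_on :: "lvec \<Rightarrow> mpoint set" where
  "points_on V = {p. touch (point_circle p) V}"

definition moebius_circle :: "mpoint set \<Rightarrow> bool" where
  "moebius_circle S \<longleftrightarrow>
     (\<exists>z \<rho>. \<rho> > 0 \<and> S = Some ` sphere z \<rho>) \<or>
     (\<exists>n d. n \<noteq> 0 \<and> S = insert None (Some ` {z. inner n z = d}))"

section \<open>Lines of the linear line complex\<close>

text \<open>Points of projective 3-space are given by nonzero homogeneous coordinate vectors; lines and
  planes are represented by the corresponding linear subspaces, which contain the vector 0.  The
  coordinates are numbered 0, 1, 2, 3 modulo 4 as elements of the index type.\<close>

definition pluecker :: "real^4 \<Rightarrow> real^4 \<Rightarrow> 4 \<Rightarrow> 4 \<Rightarrow> real" where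
  "pluecker \<alpha> \<beta> \<mu> \<nu> = \<alpha> $ \<mu> * \<beta> $ \<nu> - \<alpha> $ \<nu> * \<beta> $ \<mu>"

definition in_complex :: "real^4 \<Rightarrow> real^4 \<Rightarrow> bool" where
  "in_complex \<alpha> \<beta> \<longleftrightarrow> pluecker \<alpha> \<beta> 0 3 = pluecker \<alpha> \<beta> 1 2"

definition complex_coords :: "real^4 \<Rightarrow> real^4 \<Rightarrow> lvec" where
  "complex_coords \<alpha> \<beta> = (pluecker \<alpha> \<beta> 0 1, pluecker \<alpha> \<beta> 2 3, pluecker \<alpha> \<beta> 0 2,
     pluecker \<alpha> \<beta> 1 3, pluecker \<alpha> \<beta> 0 3)"

text \<open>The polarisation of the quadratic form 2 g01 g23 - 2 g02 g13 + 2 g03^2.\<close>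

fun complex_form :: "lvec \<Rightarrow> lvec \<Rightarrow> real" where
  "complex_form (g01, g23, g02, g13, g03) (h01, h23, h02, h13, h03) =
     (g01 * h23 + h01 * g23) - (g02 * h13 + h02 * g13) + 2 * g03 * h03"

definition lie_identification :: "(lvec \<Rightarrow> lvec) \<Rightarrow> bool" where
  "lie_identification \<Phi> \<longleftrightarrow>
     linear \<Phi> \<and> (\<forall>V V'. complex_form (\<Phi> V) (\<Phi> V') = lie_form V V')"

text \<open>Rescaling the second point rescales the coordinates of the line, so that the proportionality
  of homogeneous coordinates may be stated as an equality.\<close>

definition circle_line :: "(lvec \<Rightarrow> lvec) \<Rightarrow> lvec \<Rightarrow> (real^4) set" where
  "circle_line \<Phi> V =
     {\<alpha>. \<alpha> = 0 \<or> (\<exists>\<beta>. in_complex \<alpha> \<beta> \<and> complex_coords \<alpha> \<beta> = \<Phi> V)}"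

section \<open>Contact elements and turbines\<close>

definition contact_element :: "(lvec \<Rightarrow> lvec) \<Rightarrow> real^4 \<Rightarrow> lvec set" where
  "contact_element \<Phi> \<alpha> = {V. oriented_circle V \<and> \<alpha> \<in> circle_line \<Phi> V}"

definition located :: "(lvec \<Rightarrow> lvec) \<Rightarrow> real^4 \<Rightarrow> mpoint \<Rightarrow> bool" where
  "located \<Phi> \<alpha> p \<longleftrightarrow> point_circle p \<in> contact_element \<Phi> \<alpha>"

text \<open>The contact element of \<open>\<alpha>\<close> is the one generated by the touching circles V and V'.\<close>

definition generated_by :: "(lvec \<Rightarrow> lvec) \<Rightarrow> real^4 \<Rightarrow> lvec \<Rightarrow> lvec \<Rightarrow> bool" where
  "generated_by \<Phi> \<alpha> V V' \<longleftrightarrow> \<alpha> \<noteq> 0 \<and> circle_line \<Phi> V \<inter> circle_line \<Phi> V' = span {\<alpha>}"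

definition turbine :: "real^4 \<Rightarrow> real^4 \<Rightarrow> (real^4) set" where
  "turbine \<alpha> \<beta> = span {\<alpha>, \<beta>}"

text \<open>Proportional vectors satisfy \<open>in_complex\<close>, so its negation implies that the two
  contact elements are distinct.\<close>

definition represents_turbine ::
    "(lvec \<Rightarrow> lvec) \<Rightarrow> mpoint set \<Rightarrow> real^4 \<Rightarrow> real^4 \<Rightarrow> bool" where
  "represents_turbine \<Phi> S \<alpha> \<beta> \<longleftrightarrow>
     moebius_circle S \<and> \<not> in_complex \<alpha> \<beta> \<and>
     S = {p. \<exists>\<gamma> \<in> turbine \<alpha> \<beta>. \<gamma> \<noteq> 0 \<and> located \<Phi> \<gamma> p}"

section \<open>Correlated circles\<close>

text \<open>The vertices of a hexagon are indexed by the six-element type, whose arithmetic is modulo 6.\<close>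

definition general_position :: "(6 \<Rightarrow> real^4) \<Rightarrow> bool" where
  "general_position x \<longleftrightarrow> inj x \<and> (\<forall>I. card I = 4 \<longrightarrow> independent (x ` I))"

definition hexagon_plane :: "(6 \<Rightarrow> real^4) \<Rightarrow> 6 \<Rightarrow> (real^4) set" where
  "hexagon_plane x i = span {x (i - 1), x i, x (i + 1)}"

definition correlation_image :: "real^4^4 \<Rightarrow> real^4 \<Rightarrow> (real^4) set" where
  "correlation_image B \<alpha> = {y. inner y (B *v \<alpha>) = 0}"

definition correlation_line_image :: "real^4^4 \<Rightarrow> (real^4) set \<Rightarrow> (real^4) set" where
  "correlation_line_image B l = (\<Inter>\<alpha>\<in>l. correlation_image B \<alpha>)"

definition associated_correlation :: "real^4^4 \<Rightarrow> (6 \<Rightarrow> real^4) \<Rightarrow> bool" where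
  "associated_correlation B x \<longleftrightarrow>
     transpose B = B \<and> invertible B \<and>
     (\<forall>i. correlation_image B (x i) = hexagon_plane x (i + 3))"

text \<open>The cyclic hexagon of the circles c1, c12, c2, c23, c3, c13 (indices 1, ..., 5 and 6 = 0).\<close>

definition circle_hexagon :: "(3 \<Rightarrow> lvec) \<Rightarrow> (3 \<Rightarrow> 3 \<Rightarrow> lvec) \<Rightarrow> 6 \<Rightarrow> lvec" where
  "circle_hexagon cl clm i =
     (if i = 1 then cl 1 else if i = 2 then clm 1 2 else if i = 3 then cl 2
      else if i = 4 then clm 2 3 else if i = 5 then cl 3 else clm 1 3)"

text \<open>Consecutive edges of the hexagon meet in its vertices.\<close>

definition hexagon_vertices :: "(lvec \<Rightarrow> lvec) \<Rightarrow> (6 \<Rightarrow> lvec) \<Rightarrow> (6 \<Rightarrow> real^4) \<Rightarrow> bool" where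
  "hexagon_vertices \<Phi> e x \<longleftrightarrow>
     (\<forall>i. x i \<noteq> 0 \<and> x i \<in> circle_line \<Phi> (e i) \<inter> circle_line \<Phi> (e (i + 1)))"

definition hexagon_in_general_position :: "(lvec \<Rightarrow> lvec) \<Rightarrow> (6 \<Rightarrow> lvec) \<Rightarrow> bool" where
  "hexagon_in_general_position \<Phi> e \<longleftrightarrow> (\<exists>x. hexagon_vertices \<Phi> e x \<and> general_position x)"

definition touching_hexagon :: "(3 \<Rightarrow> lvec) \<Rightarrow> (3 \<Rightarrow> 3 \<Rightarrow> lvec) \<Rightarrow> bool" where
  "touching_hexagon cl clm \<longleftrightarrow>
     (\<forall>l. oriented_circle (cl l)) \<and>
     (\<forall>l m. l \<noteq> m \<longrightarrow> oriented_circle (clm l m) \<and> clm l m = clm m l \<and> touch (cl l) (clm l m))"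

definition touching_cube ::
    "lvec \<Rightarrow> (3 \<Rightarrow> lvec) \<Rightarrow> (3 \<Rightarrow> 3 \<Rightarrow> lvec) \<Rightarrow> lvec \<Rightarrow> bool" where
  "touching_cube c cl clm c123 \<longleftrightarrow>
     oriented_circle c \<and> oriented_circle c123 \<and> touching_hexagon cl clm \<and>
     (\<forall>l. touch c (cl l)) \<and> (\<forall>l m. l \<noteq> m \<longrightarrow> touch c123 (clm l m))"

definition correlated ::
    "(lvec \<Rightarrow> lvec) \<Rightarrow> lvec \<Rightarrow> (3 \<Rightarrow> lvec) \<Rightarrow> (3 \<Rightarrow> 3 \<Rightarrow> lvec) \<Rightarrow> lvec \<Rightarrow> bool" where
  "correlated \<Phi> c cl clm c123 \<longleftrightarrow>
     touching_cube c cl clm c123 \<and>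
     (\<exists>x B. hexagon_vertices \<Phi> (circle_hexagon cl clm) x \<and> general_position x \<and>
        associated_correlation B x \<and>
        correlation_line_image B (circle_line \<Phi> c) = circle_line \<Phi> c123 \<and>
        correlation_line_image B (circle_line \<Phi> c123) = circle_line \<Phi> c)"

section \<open>The construction\<close>

text \<open>C l, C' l m, D m and E l m n are the contact elements of the points of contact and of the
  additional points: C l of c and \<open>c_l\<close>, C' l m of \<open>c_m\<close> and \<open>c_lm\<close>, D m is shared by the turbines
  of superscripts (l, m) and (n, m), and E l m n by the turbines with superscripts (l, m), (l, n)
  and subscripts n, m respectively.\<close>

definition lie_construction ::
    "(lvec \<Rightarrow> lvec) \<Rightarrow> lvec \<Rightarrow> (3 \<Rightarrow> lvec) \<Rightarrow> (3 \<Rightarrow> 3 \<Rightarrow> lvec) \<Rightarrow>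
     (3 \<Rightarrow> real^4) \<Rightarrow> (3 \<Rightarrow> 3 \<Rightarrow> real^4) \<Rightarrow> (3 \<Rightarrow> real^4) \<Rightarrow> (3 \<Rightarrow> 3 \<Rightarrow> 3 \<Rightarrow> real^4) \<Rightarrow>
     lvec \<Rightarrow> bool" where
  "lie_construction \<Phi> c cl clm C C' D E c123 \<longleftrightarrow>
     (\<forall>l. generated_by \<Phi> (C l) c (cl l)) \<and>
     (\<forall>l m. l \<noteq> m \<longrightarrow> generated_by \<Phi> (C' l m) (cl m) (clm l m)) \<and>
     (\<forall>l m n. distinct [l, m, n] \<longrightarrow>
        D m \<noteq> 0 \<and> turbine (C l) (C' l m) \<inter> turbine (C n) (C' n m) = span {D m}) \<and>
     (\<forall>l m n. distinct [l, m, n] \<longrightarrow>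
        E l m n \<noteq> 0 \<and> E l m n = E l n m \<and>
        turbine (C' l n) (D m) \<inter> turbine (C' l m) (D n) = span {E l m n} \<and>
        clm m n \<in> contact_element \<Phi> (E l m n)) \<and>
     oriented_circle c123 \<and>
     (\<forall>V. (\<forall>l m n. distinct [l, m, n] \<longrightarrow> V \<in> contact_element \<Phi> (E l m n)) \<longleftrightarrow>
        same_circle c123 V)"

text \<open>Here p l, p' l m, q m, s l m n are the locations of the contact elements C l, C' l m, D m,
  E l m n, and A l m, A' l m n are the auxiliary circles with superscripts l, m (and subscript n).\<close>

definition planar_construction ::
    "(lvec \<Rightarrow> lvec) \<Rightarrow> (3 \<Rightarrow> 3 \<Rightarrow> lvec) \<Rightarrow>
     (3 \<Rightarrow> real^4) \<Rightarrow> (3 \<Rightarrow> 3 \<Rightarrow> real^4) \<Rightarrow> (3 \<Rightarrow> real^4) \<Rightarrow> (3 \<Rightarrow> 3 \<Rightarrow> 3 \<Rightarrow> real^4) \<Rightarrow>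
     (3 \<Rightarrow> mpoint) \<Rightarrow> (3 \<Rightarrow> 3 \<Rightarrow> mpoint) \<Rightarrow> (3 \<Rightarrow> mpoint) \<Rightarrow> (3 \<Rightarrow> 3 \<Rightarrow> 3 \<Rightarrow> mpoint) \<Rightarrow>
     (3 \<Rightarrow> 3 \<Rightarrow> mpoint set) \<Rightarrow> (3 \<Rightarrow> 3 \<Rightarrow> 3 \<Rightarrow> mpoint set) \<Rightarrow> lvec \<Rightarrow> bool" where
  "planar_construction \<Phi> clm C C' D E p p' q s A A' c123 \<longleftrightarrow>
     (\<forall>l. located \<Phi> (C l) (p l) \<and> located \<Phi> (D l) (q l)) \<and>
     (\<forall>l m. l \<noteq> m \<longrightarrow> located \<Phi> (C' l m) (p' l m)) \<and>
     (\<forall>l m n. distinct [l, m, n] \<longrightarrow> located \<Phi> (E l m n) (s l m n)) \<and>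
     (\<forall>l m. l \<noteq> m \<longrightarrow>
        A l m = A m l \<and> represents_turbine \<Phi> (A l m) (C l) (C' l m) \<and>
        {p l, p m, p' l m, p' m l} \<subseteq> A l m) \<and>
     (\<forall>l m n. distinct [l, m, n] \<longrightarrow> A l m \<inter> A n m = {p m, q m}) \<and>
     (\<forall>l m n. distinct [l, m, n] \<longrightarrow>
        A' l m n = A' m l n \<and> represents_turbine \<Phi> (A' l m n) (C' l n) (D m) \<and>
        {p' l n, p' m n, q l, q m} \<subseteq> A' l m n) \<and>
     (\<forall>l m n. distinct [l, m, n] \<longrightarrow>
        s l m n \<in> A' l m n \<inter> A' l n m \<inter> points_on (clm m n)) \<and>
     {s 1 2 3, s 2 1 3, s 3 1 2} \<subseteq> points_on c123"

definition constructed ::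
    "(lvec \<Rightarrow> lvec) \<Rightarrow> lvec \<Rightarrow> (3 \<Rightarrow> lvec) \<Rightarrow> (3 \<Rightarrow> 3 \<Rightarrow> lvec) \<Rightarrow> lvec \<Rightarrow> bool" where
  "constructed \<Phi> c cl clm c123 \<longleftrightarrow>
     (\<exists>C C' D E p p' q s A A'.
        lie_construction \<Phi> c cl clm C C' D E c123 \<and>
        planar_construction \<Phi> clm C C' D E p p' q s A A' c123)"

text \<open>The auxiliary circles and the locations belong to Moebius geometry and are not mapped to each
  other by a Lie transformation; the resulting circle nevertheless is.\<close>

definition lie_well_defined ::
    "(lvec \<Rightarrow> lvec) \<Rightarrow> lvec \<Rightarrow> (3 \<Rightarrow> lvec) \<Rightarrow> (3 \<Rightarrow> 3 \<Rightarrow> lvec) \<Rightarrow> lvec \<Rightarrow> bool" where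
  "lie_well_defined \<Phi> c cl clm c123 \<longleftrightarrow>
     (\<forall>T. lie_transformation T \<longrightarrow>
        (\<forall>V. constructed \<Phi> (T c) (\<lambda>l. T (cl l)) (\<lambda>l m. T (clm l m)) V \<longleftrightarrow>
           same_circle (T c123) V))"

end

theory Submission
  imports Defs
begin

text \<open>
  Two points of projective 3-space span a line of the complex iff the symplectic form
  \<open>sp \<alpha> \<beta> = \<gamma>\<^sup>0\<^sup>3 - \<gamma>\<^sup>1\<^sup>2\<close> vanishes, so that oriented circles are the Lagrangian planes of this form
  and two of them touch iff they meet.  The opposite sides and the diagonals of a quadrilateral of
  touching circles are then controlled by orthogonality alone: the two diagonals are polar to each
  other, \<open>D l\<close> is the only point orthogonal to \<open>C l\<close>, \<open>Y l m\<close> and \<open>Y l n\<close>, where \<open>Y\<close> is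
  the \<open>C'\<close> of the definitions, and \<open>E l m n\<close> is the only point of the line of \<open>c\<^sub>m\<^sub>n\<close>
  orthogonal to \<open>D l\<close>.  It follows that the three points
  \<open>E\<close> are pairwise orthogonal, hence lie on a line of the complex, which is \<open>c\<^sub>1\<^sub>2\<^sub>3\<close>.  Orthogonality
  of two points means that some circle belongs to both contact elements; this turns the description
  of \<open>c\<^sub>1\<^sub>2\<^sub>3\<close> into one by touching alone, which every Lie transformation preserves.  Finally the
  quadratic form of the correlation makes each hexagon vertex conjugate to all others except its
  neighbours and itself, and a short computation shows that it makes \<open>C l\<close> conjugate to \<open>D l\<close>, and
  therefore the lines of \<open>c\<close> and \<open>c\<^sub>1\<^sub>2\<^sub>3\<close> conjugate.
\<close>

section \<open>The symplectic form of the linear line complex\<close>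

text \<open>The obstacle is well-definedness. \<open>constructed\<close> contains locations and
  auxiliary circles, which a Lie transformation does not carry along, and points of projective
  3-space, on which it acts only through a collineation that would first have to be produced. Both
  are bypassed: the incidences that determine the last circle become orthogonality relations
  \<open>sp a b = 0\<close>, and these become the existence of circles with prescribed touchings, so
  that only \<open>lie_form\<close> is left to transform. Orthogonality can replace incidence
  because a line of the complex is its own \<open>sp\<close>-complement, while taking complements
  interchanges the two turbines represented by one auxiliary circle. For the same reason general
  position of the vertices is first weakened to the statement that non-adjacent sides of the hexagon
  do not touch. This is invariant and suffices for the whole construction; the vertices themselves
  return only for the correlation.\<close>

definition sp :: "real^4 \<Rightarrow> real^4 \<Rightarrow> real" where
  "sp a b = pluecker a b 0 3 - pluecker a b 1 2"

lemma in_complex_iff_sp: "in_complex a b \<longleftrightarrow> sp a b = 0"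
  by (simp add: in_complex_def sp_def)

lemma sp_coords: "sp a b = a$0 * b$3 - a$3 * b$0 - a$1 * b$2 + a$2 * b$1"
  by (simp add: sp_def pluecker_def)

lemma sp_bilinear [simp]:
  "sp (a + b) v = sp a v + sp b v" "sp v (a + b) = sp v a + sp v b"
  "sp (a - b) v = sp a v - sp b v" "sp v (a - b) = sp v a - sp v b"
  "sp (s *\<^sub>R a) v = s * sp a v" "sp v (s *\<^sub>R a) = s * sp v a"
  "sp (- a) v = - sp a v" "sp v (- a) = - sp v a" "sp 0 v = 0" "sp v 0 = 0" "sp a a = 0"
  by (simp_all add: sp_coords algebra_simps)

lemma sp_swap: "sp a b = - sp b a"
  by (simp add: sp_coords algebra_simps)

lemma sp_commute_zero: "sp a b = 0 \<longleftrightarrow> sp b a = 0"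
  using sp_swap[of a b] by simp

lemma four_eq_zero: "(4::4) = 0"
  by simp

text \<open>\<open>forall_4\<close> enumerates the indices as 1 to 4, and the last of them is the
  coordinate 0.\<close>

lemma all_index4: "(\<forall>i::4. P i) \<longleftrightarrow> P 0 \<and> P 1 \<and> P 2 \<and> P 3"
  unfolding forall_4 four_eq_zero by blast

lemma vec4_eq_iff: "(a::real^4) = b \<longleftrightarrow> a$0 = b$0 \<and> a$1 = b$1 \<and> a$2 = b$2 \<and> a$3 = b$3"
  by (simp add: vec_eq_iff all_index4)

definition mk4 :: "real \<Rightarrow> real \<Rightarrow> real \<Rightarrow> real \<Rightarrow> real^4" where
  "mk4 p q r s = (\<chi> i. if i = 0 then p else if i = 1 then q else if i = 2 then r else s)"

lemma mk4_nth [simp]: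
  "mk4 p q r s $ 0 = p" "mk4 p q r s $ 1 = q" "mk4 p q r s $ 2 = r" "mk4 p q r s $ 3 = s"
  by (simp_all add: mk4_def)

lemma sp_nondegenerate:
  assumes "\<And>u. sp v u = 0"
  shows "v = 0"
  using assms[of "mk4 1 0 0 0"] assms[of "mk4 0 1 0 0"] assms[of "mk4 0 0 1 0"]
    assms[of "mk4 0 0 0 1"]
  by (simp add: sp_coords vec4_eq_iff)

definition pf :: "real^4 \<Rightarrow> real^4 \<Rightarrow> real^4 \<Rightarrow> real^4 \<Rightarrow> real" where
  "pf a b c d = sp a b * sp c d - sp a c * sp b d + sp a d * sp b c"

text \<open>Cramer's rule, since the Pfaffian of the Gram matrix is the determinant of four vectors.\<close>

lemma pf_cramer:
  "pf a b c d *\<^sub>R w = pf w b c d *\<^sub>R a + pf a w c d *\<^sub>R b + pf a b w d *\<^sub>R c + pf a b c w *\<^sub>R d"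
  unfolding vec4_eq_iff pf_def sp_coords vector_add_component vector_scaleR_component
    real_scaleR_def
  by (intro conjI; algebra)

section \<open>Planes of the symplectic space: complements and intersections\<close>

lemma span_pair_iff: "v \<in> span {a, b} \<longleftrightarrow> (\<exists>s t. v = s *\<^sub>R a + t *\<^sub>R (b :: real^4))"
  by (auto simp: span_insert span_singleton algebra_simps)

lemma pair_in_span: "a \<in> span {a, b}" "b \<in> span {a, b}"
  by (simp_all add: span_base)

definition nonparallel :: "real^4 \<Rightarrow> real^4 \<Rightarrow> bool" where
  "nonparallel a b \<longleftrightarrow> (\<forall>s t. s *\<^sub>R a + t *\<^sub>R b = 0 \<longrightarrow> s = 0 \<and> t = 0)"

lemma nonparallelD: "nonparallel a b \<Longrightarrow> s *\<^sub>R a + t *\<^sub>R b = 0 \<Longrightarrow> s = 0 \<and> t = 0"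
  by (simp add: nonparallel_def)

lemma nonparallel_eqD: "nonparallel a b \<Longrightarrow> s *\<^sub>R a = t *\<^sub>R b \<Longrightarrow> s = 0 \<and> t = 0"
  using nonparallelD[of a b s "- t"] by simp

lemma nonparallel_nonzero: "nonparallel a b \<Longrightarrow> a \<noteq> 0 \<and> b \<noteq> 0"
  using nonparallelD[of a b 1 0] nonparallelD[of a b 0 1] by auto

lemma not_nonparallel:
  assumes "\<not> nonparallel a b" "a \<noteq> 0"
  shows "b \<in> span {a}"
proof -
  obtain s t where st: "s *\<^sub>R a + t *\<^sub>R b = 0" "\<not> (s = 0 \<and> t = 0)"
    using assms(1) by (auto simp: nonparallel_def)
  then have "t \<noteq> 0" using assms(2) by auto
  have "t *\<^sub>R b = (- s) *\<^sub>R a" using st(1) by (simp add: eq_neg_iff_add_eq_0 add.commute)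
  then have "(1 / t) *\<^sub>R (t *\<^sub>R b) = (1 / t) *\<^sub>R ((- s) *\<^sub>R a)" by simp
  then have "b = (- s / t) *\<^sub>R a" using \<open>t \<noteq> 0\<close> by simp
  then show ?thesis unfolding span_singleton by blast
qed

lemma nonparallelI: "a \<noteq> 0 \<Longrightarrow> b \<notin> span {a} \<Longrightarrow> nonparallel a b"
  using not_nonparallel by blast

lemma span_singleton_commute:
  assumes "(b :: real^4) \<in> span {a}" "b \<noteq> 0"
  shows "a \<in> span {b}"
proof -
  obtain k where "b = k *\<^sub>R a" using assms(1) by (auto simp: span_singleton)
  then have "a = (1 / k) *\<^sub>R b" using assms(2) by auto
  then show ?thesis unfolding span_singleton by blast
qed

lemma in_subspace_if_parallel:
  assumes "subspace S" "a \<in> S" "v \<in> span {a :: real^4}"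
  shows "v \<in> S"
  using assms by (auto simp: span_singleton subspace_scale)

text \<open>A Lagrangian plane is its own complement: some \<open>c\<close>, \<open>d\<close>
  complete \<open>a\<close>, \<open>b\<close> to a basis, and in Cramer's rule for \<open>v\<close>
  the coefficients of \<open>c\<close> and \<open>d\<close> vanish.\<close>

lemma isotropic_span:
  assumes "nonparallel a b" "sp a b = 0" "sp a v = 0" "sp b v = 0"
  shows "v \<in> span {a, b}"
proof -
  have "\<exists>c d. pf a b c d \<noteq> 0"
  proof (rule ccontr)
    assume "\<not> ?thesis"
    then have z: "sp a c * sp b d = sp a d * sp b c" for c d
      using assms(2) by (simp add: pf_def)
    have "b \<noteq> 0" using assms(1) nonparallel_nonzero by blast
    then obtain d where d: "sp b d \<noteq> 0" using sp_nondegenerate by blast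
    \<comment> \<open>If all Pfaffians vanished, this combination would be orthogonal to everything,
      hence zero, although its coefficient of \<open>a\<close> is not.\<close>
    have "sp (sp b d *\<^sub>R a - sp a d *\<^sub>R b) c = 0" for c
      using z[of c d] by (simp add: algebra_simps)
    then have "sp b d *\<^sub>R a - sp a d *\<^sub>R b = 0" by (rule sp_nondegenerate)
    then have "sp b d *\<^sub>R a + (- sp a d) *\<^sub>R b = 0" by simp
    then show False using nonparallelD[OF assms(1)] d by blast
  qed
  then obtain c d where k: "pf a b c d \<noteq> 0" by blast
  have "pf a b c d *\<^sub>R v = pf v b c d *\<^sub>R a + pf a v c d *\<^sub>R b"
    using pf_cramer[of a b c d v] assms(2-) by (simp add: pf_def)
  then have "(1 / pf a b c d) *\<^sub>R (pf a b c d *\<^sub>R v)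
      = (1 / pf a b c d) *\<^sub>R (pf v b c d *\<^sub>R a + pf a v c d *\<^sub>R b)" by simp
  then have "v = (pf v b c d / pf a b c d) *\<^sub>R a + (pf a v c d / pf a b c d) *\<^sub>R b"
    using k by (simp add: scaleR_add_right)
  then show ?thesis unfolding span_pair_iff by blast
qed

lemma sp_span_pair:
  assumes "v \<in> span {a, b}" "sp w a = 0" "sp w b = 0"
  shows "sp w v = 0" "sp v w = 0"
  using assms sp_swap[of v w] by (auto simp: span_pair_iff)

text \<open>A vector \<open>s c + t d\<close> lies in the isotropic plane iff it is orthogonal to
  \<open>a\<close> and \<open>b\<close>. These are two linear equations for \<open>s\<close> and
  \<open>t\<close>, whose determinant is the right-hand side.\<close>

lemma isotropic_meets_iff:
  assumes "nonparallel a b" "sp a b = 0" "nonparallel c d"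
  shows "(\<exists>u. u \<noteq> 0 \<and> u \<in> span {a, b} \<and> u \<in> span {c, d})
    \<longleftrightarrow> sp a c * sp b d - sp a d * sp b c = 0"
proof
  assume "sp a c * sp b d - sp a d * sp b c = 0"
  then have z: "sp a c * sp b d = sp a d * sp b c" by simp
  \<comment> \<open>A nonzero kernel vector of the singular 2 by 2 matrix, read off from a nonzero
    row if there is one.\<close>
  obtain s t where st: "\<not> (s = 0 \<and> t = 0)" "s * sp a c + t * sp a d = 0" "s * sp b c + t * sp b d = 0"
  proof (cases "sp a c = 0 \<and> sp a d = 0")
    case True
    then show ?thesis
      using that[of 1 0] that[of "sp b d" "- sp b c"] by (cases "sp b c = 0") auto
  next
    case False
    then have "\<not> (sp a d = 0 \<and> - sp a c = 0)" by auto
    moreover have "sp a d * sp a c + - sp a c * sp a d = 0" by simp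
    moreover have "sp a d * sp b c + - sp a c * sp b d = 0" using z by simp
    ultimately show ?thesis using that by blast
  qed
  define u where "u = s *\<^sub>R c + t *\<^sub>R d"
  have "u \<noteq> 0" using nonparallelD[OF assms(3), of s t] st(1) by (auto simp: u_def)
  moreover have "sp a u = 0" "sp b u = 0" using st by (simp_all add: u_def)
  then have "u \<in> span {a, b}" using isotropic_span[OF assms(1,2)] by blast
  moreover have "u \<in> span {c, d}" using span_pair_iff u_def by blast
  ultimately show "\<exists>u. u \<noteq> 0 \<and> u \<in> span {a, b} \<and> u \<in> span {c, d}" by blast
next
  assume "\<exists>u. u \<noteq> 0 \<and> u \<in> span {a, b} \<and> u \<in> span {c, d}"
  then obtain u where u: "u \<noteq> 0" "u \<in> span {a, b}" "u \<in> span {c, d}" by blast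
  then obtain s t where st: "u = s *\<^sub>R c + t *\<^sub>R d" using span_pair_iff by blast
  have "sp a u = 0" "sp b u = 0"
    using u(2) assms(2) sp_commute_zero[of b a] sp_span_pair(1) by auto
  then have e: "s * sp a c + t * sp a d = 0" "s * sp b c + t * sp b d = 0"
    by (simp_all add: st)
  have "s * (sp a c * sp b d - sp a d * sp b c) = 0" "t * (sp a c * sp b d - sp a d * sp b c) = 0"
    using e by algebra+
  moreover have "s \<noteq> 0 \<or> t \<noteq> 0" using u(1) st by auto
  ultimately show "sp a c * sp b d - sp a d * sp b c = 0" by auto
qed

lemma nonparallel_if_sp:
  assumes "sp a b \<noteq> 0"
  shows "nonparallel a b"
  unfolding nonparallel_def
proof (intro allI impI)
  fix s t assume "s *\<^sub>R a + t *\<^sub>R b = 0"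
  then have "sp (s *\<^sub>R a + t *\<^sub>R b) b = 0" "sp a (s *\<^sub>R a + t *\<^sub>R b) = 0" by (simp_all only: sp_bilinear)
  then show "s = 0 \<and> t = 0" using assms by simp
qed

text \<open>The Pfaffian of the four vectors reduces to \<open>sp a b * sp a' b'\<close>, so they
  form a basis; orthogonality of \<open>v\<close> to \<open>a'\<close> and \<open>b'\<close> removes
  these two from its expansion.\<close>

lemma polar_span:
  assumes "sp a b \<noteq> 0" "sp a' b' \<noteq> 0"
    and "sp a a' = 0" "sp a b' = 0" "sp b a' = 0" "sp b b' = 0"
    and "sp v a' = 0" "sp v b' = 0"
  shows "v \<in> span {a, b}"
proof -
  have "pf a b a' b' *\<^sub>R v = pf v b a' b' *\<^sub>R a + pf a v a' b' *\<^sub>R b"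
    using pf_cramer[of a b a' b' v] assms(3-) sp_swap[of v a'] sp_swap[of v b'] by (simp add: pf_def)
  moreover have k: "pf a b a' b' \<noteq> 0" using assms by (simp add: pf_def)
  ultimately have "(1 / pf a b a' b') *\<^sub>R (pf a b a' b' *\<^sub>R v)
      = (1 / pf a b a' b') *\<^sub>R (pf v b a' b' *\<^sub>R a + pf a v a' b' *\<^sub>R b)" by simp
  then have "v = (pf v b a' b' / pf a b a' b') *\<^sub>R a + (pf a v a' b' / pf a b a' b') *\<^sub>R b"
    using k by (simp add: scaleR_add_right)
  then show ?thesis unfolding span_pair_iff by blast
qed

text \<open>A plane not contained in \<open>S\<close> meets it in at most one projective point:
  eliminating \<open>b\<close> between \<open>v\<close> and \<open>w\<close> leaves a multiple of
  \<open>a\<close> in \<open>S\<close>.\<close>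

lemma span_pair_inter:
  assumes "subspace S" "a \<notin> S" "w \<in> span {a, b}" "w \<in> S" "w \<noteq> (0::real^4)"
  shows "span {a, b} \<inter> S = span {w}"
proof
  show "span {w} \<subseteq> span {a, b} \<inter> S"
    using assms(1,3,4) in_subspace_if_parallel subspace_span by blast
  obtain p q where w: "w = p *\<^sub>R a + q *\<^sub>R b" using assms(3) span_pair_iff by blast
  have "q \<noteq> 0"
  proof
    assume "q = 0"
    then have "p \<noteq> 0" using w assms(5) by auto
    then have "a = (1 / p) *\<^sub>R w" using w \<open>q = 0\<close> by simp
    then show False using assms(1,2,4) by (metis subspace_scale)
  qed
  show "span {a, b} \<inter> S \<subseteq> span {w}"
  proof
    fix v assume v: "v \<in> span {a, b} \<inter> S"
    then obtain s t where st: "v = s *\<^sub>R a + t *\<^sub>R b" using span_pair_iff by blast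
    have "q *\<^sub>R v - t *\<^sub>R w \<in> S"
      using v assms(1,4) by (simp add: subspace_diff subspace_scale)
    moreover have "q *\<^sub>R v - t *\<^sub>R w = (q * s - t * p) *\<^sub>R a"
      by (simp add: st w algebra_simps)
    ultimately have "(q * s - t * p) *\<^sub>R a \<in> S" by simp
    then have "q * s - t * p = 0"
      using assms(1,2) subspace_scale[of S "(q * s - t * p) *\<^sub>R a" "1 / (q * s - t * p)"]
      by (cases "q * s - t * p = 0") auto
    then have "q *\<^sub>R v = t *\<^sub>R w"
      using \<open>q *\<^sub>R v - t *\<^sub>R w = (q * s - t * p) *\<^sub>R a\<close> by simp
    then have "(1 / q) *\<^sub>R (q *\<^sub>R v) = (1 / q) *\<^sub>R (t *\<^sub>R w)" by simp
    then have "v = (t / q) *\<^sub>R w" using \<open>q \<noteq> 0\<close> by simp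
    then show "v \<in> span {w}" by (auto simp: span_singleton)
  qed
qed

section \<open>Lagrangian planes\<close>

definition lagrangian :: "(real^4) set \<Rightarrow> bool" where
  "lagrangian L \<longleftrightarrow> (\<exists>a b. nonparallel a b \<and> sp a b = 0 \<and> L = span {a, b})"

lemma lagrangian_subspace: "lagrangian L \<Longrightarrow> subspace L"
  by (auto simp: lagrangian_def)

lemma lagrangian_isotropic: "lagrangian L \<Longrightarrow> u \<in> L \<Longrightarrow> v \<in> L \<Longrightarrow> sp u v = 0"
proof -
  assume uv: "u \<in> L" "v \<in> L" and "lagrangian L"
  then obtain a b where "sp a b = 0" "L = span {a, b}"
    by (auto simp: lagrangian_def)
  then show ?thesis using uv sp_swap[of b a] by (auto simp: span_pair_iff)
qed

lemma lagrangian_eq_span: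
  assumes "lagrangian L" "nonparallel a b" "a \<in> L" "b \<in> L"
  shows "L = span {a, b}"
proof
  show "span {a, b} \<subseteq> L"
    using assms lagrangian_subspace by (simp add: span_minimal)
  show "L \<subseteq> span {a, b}"
    using assms isotropic_span lagrangian_isotropic by blast
qed

lemma lagrangian_in:
  assumes "lagrangian L" "nonparallel a b" "a \<in> L" "b \<in> L" "sp a v = 0" "sp b v = 0"
  shows "v \<in> L"
  using lagrangian_eq_span[OF assms(1-4)] isotropic_span[of a b v] assms
    lagrangian_isotropic by blast

lemma lagrangian_spanI: "nonparallel a b \<Longrightarrow> sp a b = 0 \<Longrightarrow> lagrangian (span {a, b})"
  by (auto simp: lagrangian_def)

text \<open>Two independent common vectors would span both planes.\<close>

lemma lagrangian_inter:
  assumes "lagrangian L" "lagrangian M" "L \<noteq> M" "u \<in> L" "u \<in> M" "u \<noteq> 0"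
  shows "L \<inter> M = span {u}"
proof
  show "span {u} \<subseteq> L \<inter> M"
    using assms by (simp add: lagrangian_subspace span_minimal)
  show "L \<inter> M \<subseteq> span {u}"
  proof
    fix v assume v: "v \<in> L \<inter> M"
    show "v \<in> span {u}"
    proof (rule ccontr)
      assume "v \<notin> span {u}"
      then have "nonparallel u v" using assms nonparallelI by blast
      then show False
        using lagrangian_eq_span[of L u v] lagrangian_eq_span[of M u v] assms v by blast
    qed
  qed
qed

text \<open>In the null polarity a pencil of lines through a point is also the pencil of lines in a
  plane, so that no three lines of a complex form a triangle.\<close>

lemma lagrangian_concurrent:
  assumes "lagrangian L" "lagrangian M" "lagrangian N" "u \<in> L" "u \<in> M"
    and "L \<inter> M = span {u}"
    and "a \<in> N" "a \<in> L" "a \<noteq> 0" "b \<in> N" "b \<in> M" "b \<noteq> 0"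
  shows "u \<in> N"
proof (cases "nonparallel a b")
  case True
  then show ?thesis
    using lagrangian_in[of N a b u] lagrangian_isotropic assms by blast
next
  case False
  then have "b \<in> span {a}" using not_nonparallel assms by blast
  then have "b \<in> L \<inter> M"
    using assms lagrangian_subspace in_subspace_if_parallel by blast
  then have "u \<in> span {b}" using assms span_singleton_commute by blast
  then show ?thesis
    using assms lagrangian_subspace in_subspace_if_parallel by blast
qed

text \<open>A line of the complex that meets one of two polar lines meets the other. The vector
  \<open>v\<close> is already orthogonal to \<open>a'\<close> and \<open>b'\<close>; if
  \<open>z\<close> completes it to a basis of \<open>L\<close>, then \<open>sp z w = 0\<close> is a
  single linear condition on the second plane.\<close>

lemma lagrangian_meets_polar:
  assumes L: "lagrangian L" and "v \<in> L" "v \<noteq> 0" "v \<in> span {a, b}"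
    and "sp a' b' \<noteq> 0"
    and "sp a a' = 0" "sp a b' = 0" "sp b a' = 0" "sp b b' = 0"
  shows "\<exists>w \<in> L. w \<noteq> 0 \<and> w \<in> span {a', b'}"
proof -
  have va: "sp v a' = 0" "sp v b' = 0"
    using assms(4,6-) by (auto simp: span_pair_iff)
  have "\<exists>z \<in> L. z \<notin> span {v}"
  proof -
    obtain p q where pq: "nonparallel p q" "L = span {p, q}"
      using L lagrangian_def by auto
    show ?thesis
    proof (rule ccontr)
      assume "\<not> ?thesis"
      then have "p \<in> span {v}" "q \<in> span {v}" using pq(2) pair_in_span by blast+
      then obtain s t where "p = s *\<^sub>R v" "q = t *\<^sub>R v" by (auto simp: span_singleton)
      then have "t *\<^sub>R p + (- s) *\<^sub>R q = 0" by simp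
      then have "t = 0 \<and> - s = 0" using nonparallelD[OF pq(1)] by blast
      then have "p = 0" using \<open>p = s *\<^sub>R v\<close> by simp
      then show False using pq nonparallel_nonzero by blast
    qed
  qed
  then obtain z where z: "z \<in> L" "z \<notin> span {v}" by blast
  then have np: "nonparallel v z" using assms nonparallelI by blast
  \<comment> \<open>When \<open>a'\<close> is not itself a solution, the coefficient of
    \<open>b'\<close> is nonzero, so \<open>w\<close> never vanishes.\<close>
  define w where "w = (if sp z a' = 0 then a' else sp z b' *\<^sub>R a' - sp z a' *\<^sub>R b')"
  have "w \<noteq> 0"
  proof
    assume "w = 0"
    then have 0: "sp w b' = 0" "sp a' w = 0" by simp_all
    show False
      using 0 assms(5) by (cases "sp z a' = 0") (simp_all add: w_def)
  qed
  moreover have "sp v w = 0" "sp z w = 0" using va by (auto simp: w_def)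
  then have "w \<in> L" using lagrangian_in[OF L np] z assms by blast
  moreover have "w \<in> span {a', b'}"
    by (simp add: w_def pair_in_span span_diff span_scale)
  ultimately show ?thesis by blast
qed

section \<open>Circles as Lagrangian planes\<close>

lemma pluecker_swap: "pluecker a b i j = - pluecker a b j i"
  by (simp add: pluecker_def)

lemma pluecker_self [simp]: "pluecker a b i i = 0"
  by (simp add: pluecker_def)

lemma complex_coords_combination:
  "complex_coords (s *\<^sub>R a + t *\<^sub>R b) (p *\<^sub>R a + q *\<^sub>R b) = (s * q - t * p) *\<^sub>R complex_coords a b"
  by (simp add: complex_coords_def pluecker_def algebra_simps)

text \<open>The coordinates leave out the pair 1, 2, which the equation of the complex recovers from
  the pair 0, 3; antisymmetry yields the others.\<close>

lemma complex_coords_determine_pluecker: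
  assumes "complex_coords a b = complex_coords a' b'" "sp a b = 0" "sp a' b' = 0"
  shows "pluecker a b i j = pluecker a' b' i j"
proof -
  have "pluecker a b 0 1 = pluecker a' b' 0 1" "pluecker a b 2 3 = pluecker a' b' 2 3"
    "pluecker a b 0 2 = pluecker a' b' 0 2" "pluecker a b 1 3 = pluecker a' b' 1 3"
    "pluecker a b 0 3 = pluecker a' b' 0 3" "pluecker a b 1 2 = pluecker a' b' 1 2"
    using assms by (simp_all add: complex_coords_def sp_def)
  moreover have "\<forall>i j. pluecker a b i j = pluecker a' b' i j"
    unfolding all_index4 using calculation
    by (simp add: pluecker_swap[of _ _ 1 0] pluecker_swap[of _ _ 2 0] pluecker_swap[of _ _ 3 0]
        pluecker_swap[of _ _ 2 1] pluecker_swap[of _ _ 3 1] pluecker_swap[of _ _ 3 2])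
  ultimately show ?thesis by blast
qed

text \<open>The left-hand side is the contraction of the bivector of \<open>a\<close> and
  \<open>b\<close> with \<open>sp\<close>. It depends on the Pluecker coordinates alone and so
  recovers the line from them without a case distinction on which coordinate is nonzero.\<close>

lemma pluecker_action:
  "(sp b v *\<^sub>R a - sp a v *\<^sub>R b) $ j
     = v$3 * pluecker a b j 0 - v$0 * pluecker a b j 3 - v$2 * pluecker a b j 1 + v$1 * pluecker a b j 2"
  by (simp add: sp_coords pluecker_def algebra_simps)

lemma complex_coords_action:
  assumes "complex_coords a b = complex_coords a' b'" "sp a b = 0" "sp a' b' = 0"
  shows "sp b v *\<^sub>R a - sp a v *\<^sub>R b = sp b' v *\<^sub>R a' - sp a' v *\<^sub>R b'"
  unfolding vec_eq_iff pluecker_action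
  using complex_coords_determine_pluecker[OF assms] by simp

lemma complex_coords_nonzero:
  assumes "nonparallel a b" "sp a b = 0"
  shows "complex_coords a b \<noteq> 0"
proof
  assume 0: "complex_coords a b = 0"
  have "complex_coords 0 0 = 0" by (simp add: complex_coords_def pluecker_def zero_prod_def)
  then have "sp b v *\<^sub>R a - sp a v *\<^sub>R b = 0" for v
    using complex_coords_action[of a b 0 0 v] 0 assms by simp
  then have "sp b v *\<^sub>R a + (- sp a v) *\<^sub>R b = 0" for v by simp
  then have "sp b v = 0" for v using nonparallelD[OF assms(1)] by blast
  then show False using sp_nondegenerate nonparallel_nonzero assms(1) by blast
qed

lemma nonparallel_if_complex_coords_nonzero:
  assumes "complex_coords a b \<noteq> 0"
  shows "nonparallel a b"
  unfolding nonparallel_def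
proof (intro allI impI)
  fix s t :: real
  assume 0: "s *\<^sub>R a + t *\<^sub>R b = 0"
  have "complex_coords 0 v = 0" for v
    by (simp add: complex_coords_def pluecker_def zero_prod_def)
  then have "(s * q - t * p) *\<^sub>R complex_coords a b = 0" for p q
    using complex_coords_combination[of s a t b p q] 0 by simp
  then have "s * q - t * p = 0" for p q using assms by simp
  from this[of 1 0] this[of 0 1] show "s = 0 \<and> t = 0" by simp
qed

text \<open>For a line outside the complex, \<open>\<gamma>\<^sup>0\<^sup>3\<close> and \<open>\<gamma>\<^sup>1\<^sup>2\<close> are replaced by their mean: this is the
  orthogonal projection of the Pluecker vector to the hyperplane of the complex.\<close>

definition turbine_coords :: "real^4 \<Rightarrow> real^4 \<Rightarrow> lvec" where
  "turbine_coords a b = (pluecker a b 0 1, pluecker a b 2 3, pluecker a b 0 2,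
     pluecker a b 1 3, (pluecker a b 0 3 + pluecker a b 1 2) / 2)"

lemma turbine_coords_in_complex: "sp a b = 0 \<Longrightarrow> turbine_coords a b = complex_coords a b"
  by (simp add: turbine_coords_def complex_coords_def sp_def)

text \<open>A line of the complex has equal coordinates 03 and 12, so pairing it with their mean on
  the other line reproduces the full Klein form. That form is, up to sign, the determinant of the
  four points, hence the Pfaffian.\<close>

lemma complex_form_turbine:
  assumes "sp a b = 0"
  shows "complex_form (complex_coords a b) (turbine_coords c d) = sp a c * sp b d - sp a d * sp b c"
proof -
  have "complex_form (complex_coords a b) (turbine_coords c d)
      = pluecker a b 0 1 * pluecker c d 2 3 + pluecker a b 2 3 * pluecker c d 0 1
      - pluecker a b 0 2 * pluecker c d 1 3 - pluecker a b 1 3 * pluecker c d 0 2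
      + pluecker a b 0 3 * pluecker c d 1 2 + pluecker a b 1 2 * pluecker c d 0 3"
    using assms by (simp add: complex_coords_def turbine_coords_def sp_def algebra_simps)
  also have "\<dots> = - pf a b c d"
    unfolding pf_def sp_coords pluecker_def by algebra
  finally show ?thesis using assms by (simp add: pf_def)
qed

text \<open>The Pluecker relation turns the norm into the difference of the squared half-sum and the
  product of the coordinates 03 and 12, doubled: a square that vanishes exactly on the
  complex.\<close>

lemma complex_form_turbine_self:
  "complex_form (turbine_coords a b) (turbine_coords a b) = (sp a b)\<^sup>2 / 2"
proof -
  have "pluecker a b 0 1 * pluecker a b 2 3 - pluecker a b 0 2 * pluecker a b 1 3
      = - pluecker a b 0 3 * pluecker a b 1 2"
    unfolding pluecker_def by algebra
  then show ?thesis
    by (simp add: turbine_coords_def sp_def power2_eq_square algebra_simps add_divide_distrib)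
qed

lemma complex_form_lines:
  assumes "sp a b = 0" "sp c d = 0"
  shows "complex_form (complex_coords a b) (complex_coords c d) = sp a c * sp b d - sp a d * sp b c"
  using complex_form_turbine[OF assms(1), of c d] turbine_coords_in_complex[OF assms(2)] by simp

text \<open>By the quadratic relation a nonzero null vector cannot have the last coordinate only. If
  the coordinate ij is nonzero, the line meets the planes where coordinate i or coordinate j
  vanishes in two distinct points; these, rescaled, are the witnesses.\<close>

lemma complex_coords_surjective:
  assumes "complex_form g g = 0" "g \<noteq> 0"
  shows "\<exists>a b. sp a b = 0 \<and> complex_coords a b = g"
proof -
  obtain g01 g23 g02 g13 g03 where g: "g = (g01, g23, g02, g13, g03)"
    by (metis prod.exhaust)
  have q: "g01 * g23 - g02 * g13 + g03 * g03 = 0"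
    using assms(1) by (simp add: g algebra_simps)
  have nz: "g01 \<noteq> 0 \<or> g23 \<noteq> 0 \<or> g02 \<noteq> 0 \<or> g13 \<noteq> 0"
    using q assms(2) by (auto simp: g zero_prod_def)
  have I: ?thesis if "sp a b = 0" "complex_coords a b = g" for a b
    using that by blast
  consider "g01 \<noteq> 0" | "g23 \<noteq> 0" | "g02 \<noteq> 0" | "g13 \<noteq> 0" using nz by blast
  then show ?thesis
  proof cases
    case 1
    then show ?thesis
      using q by (intro I[of "mk4 1 0 (- g03 / g01) (- g13 / g01)" "mk4 0 g01 g02 g03"])
        (simp_all add: g sp_coords complex_coords_def pluecker_def field_simps)
  next
    case 2
    then show ?thesis
      using q by (intro I[of "mk4 (g03 / g23) (g13 / g23) 1 0" "mk4 (- g02) (- g03) 0 g23"])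
        (simp_all add: g sp_coords complex_coords_def pluecker_def field_simps)
  next
    case 3
    then show ?thesis
      using q by (intro I[of "mk4 1 (g03 / g02) 0 (- g23 / g02)" "mk4 0 g01 g02 g03"])
        (simp_all add: g sp_coords complex_coords_def pluecker_def field_simps)
  next
    case 4
    then show ?thesis
      using q by (intro I[of "mk4 (g03 / g13) 1 (g23 / g13) 0" "mk4 (- g01) 0 g03 g13"])
        (simp_all add: g sp_coords complex_coords_def pluecker_def field_simps)
  qed
qed

section \<open>The Lie quadric and the lines of its circles\<close>

lemma lie_form_zero_right [simp]: "lie_form V 0 = 0"
  by (cases V) (simp add: zero_prod_def)

lemma lie_form_nondegenerate:
  assumes "\<And>W. lie_form V W = 0"
  shows "V = 0"
proof -
  obtain x y a b r where V: "V = (x, y, a, b, r)" by (metis prod.exhaust)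
  show ?thesis
    using assms[of "(1,0,0,0,0)"] assms[of "(0,1,0,0,0)"] assms[of "(0,0,1,0,0)"]
      assms[of "(0,0,0,1,0)"] assms[of "(0,0,0,0,1)"]
    by (simp add: V zero_prod_def)
qed

lemma lie_form_commute: "lie_form V W = lie_form W V"
  by (cases V; cases W) (auto simp: algebra_simps)

lemma lie_form_scale [simp]:
  "lie_form (k *\<^sub>R V) W = k * lie_form V W" "lie_form V (k *\<^sub>R W) = k * lie_form V W"
  by (cases V; cases W; simp add: algebra_simps add_divide_distrib diff_divide_distrib)+

lemma touch_commute: "touch V W \<longleftrightarrow> touch W V"
  by (simp add: touch_def lie_form_commute)

lemma same_circle_sym: "same_circle V W \<Longrightarrow> same_circle W V"
  unfolding same_circle_def by (metis inverse_nonzero_iff_nonzero scaleR_scaleR left_inverse scaleR_one)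

lemma same_circle_trans: "same_circle U V \<Longrightarrow> same_circle V W \<Longrightarrow> same_circle U W"
  unfolding same_circle_def by (metis mult_eq_0_iff scaleR_scaleR)

lemma same_circle_touch: "same_circle V V' \<Longrightarrow> touch V' W \<longleftrightarrow> touch V W"
  by (auto simp: same_circle_def touch_def)

lemma same_circle_oriented: "same_circle V V' \<Longrightarrow> oriented_circle V' \<longleftrightarrow> oriented_circle V"
  by (auto simp: same_circle_def oriented_circle_def)

locale lie_model =
  fixes \<Phi> :: "lvec \<Rightarrow> lvec"
  assumes ident: "lie_identification \<Phi>"
begin

abbreviation ln :: "lvec \<Rightarrow> (real^4) set" where
  "ln V \<equiv> circle_line \<Phi> V"

lemma linear_ident: "linear \<Phi>"
  using ident by (simp add: lie_identification_def)

lemma complex_form_ident: "complex_form (\<Phi> V) (\<Phi> W) = lie_form V W"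
  using ident unfolding lie_identification_def by blast

lemma ident_eq_0: "\<Phi> V = 0 \<longleftrightarrow> V = 0"
proof
  assume "\<Phi> V = 0"
  then have "lie_form V W = 0" for W
    using complex_form_ident[of V W] by (cases "\<Phi> W") (simp add: zero_prod_def)
  then show "V = 0" by (rule lie_form_nondegenerate)
qed (simp add: linear_0[OF linear_ident])

lemma inj_ident: "inj \<Phi>"
  using ident_eq_0 linear_injective_0[OF linear_ident] by blast

lemma surj_ident: "surj \<Phi>"
  by (rule linear_injective_imp_surjective[OF linear_ident inj_ident]) simp

lemma circle_line_eq_span:
  assumes "sp a b = 0" "\<Phi> V = complex_coords a b" "nonparallel a b"
  shows "ln V = span {a, b}"
proof
  show "span {a, b} \<subseteq> ln V"
  proof
    fix v assume "v \<in> span {a, b}"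
    then obtain s t where v: "v = s *\<^sub>R a + t *\<^sub>R b" using span_pair_iff by blast
    show "v \<in> ln V"
    proof (cases "s = 0 \<and> t = 0")
      case True
      then show ?thesis by (simp add: v circle_line_def)
    next
      case False
      \<comment> \<open>A second point with determinant 1 makes the coordinates agree exactly, as
        \<open>circle_line\<close> demands, and not just up to a factor.\<close>
      then obtain p q where "s * q - t * p = 1"
      proof (cases "s = 0")
        case True
        then show ?thesis using False that[of 0 "- 1 / t"] by simp
      next
        case s: False
        then show ?thesis using that[of "1 / s" 0] by simp
      qed
      then have "complex_coords v (p *\<^sub>R a + q *\<^sub>R b) = complex_coords a b"
        using complex_coords_combination v by simp
      moreover have "in_complex v (p *\<^sub>R a + q *\<^sub>R b)"
        using assms(1) sp_swap[of b a] by (simp add: v in_complex_iff_sp)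
      ultimately show ?thesis using assms(2) by (auto simp: circle_line_def)
    qed
  qed
  show "ln V \<subseteq> span {a, b}"
  proof
    fix v assume "v \<in> ln V"
    then consider "v = 0" | w where "sp v w = 0" "complex_coords v w = complex_coords a b"
      using assms(2) by (auto simp: circle_line_def in_complex_iff_sp)
    then show "v \<in> span {a, b}"
    proof cases
      case 1
      then show ?thesis by (simp add: span_zero)
    next
      case 2
      \<comment> \<open>The contraction may be computed from the points \<open>v\<close> and
        \<open>w\<close> of the same line, and both \<open>sp v v\<close> and \<open>sp w v\<close>
        are zero.\<close>
      have "sp b v *\<^sub>R a - sp a v *\<^sub>R b = 0"
        using complex_coords_action[of a b v w v] 2 assms(1) sp_swap[of v w] by simp
      then have "sp b v *\<^sub>R a + (- sp a v) *\<^sub>R b = 0" by simp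
      then have "sp b v = 0 \<and> - sp a v = 0" using nonparallelD[OF assms(3)] by blast
      then show ?thesis using isotropic_span[OF assms(3,1)] by simp
    qed
  qed
qed

lemma oriented_circle_coords:
  assumes "oriented_circle V"
  obtains a b where "nonparallel a b" "sp a b = 0" "\<Phi> V = complex_coords a b" "ln V = span {a, b}"
proof -
  have "complex_form (\<Phi> V) (\<Phi> V) = 0" "\<Phi> V \<noteq> 0"
    using assms by (auto simp: oriented_circle_def complex_form_ident ident_eq_0)
  then obtain a b where ab: "sp a b = 0" "complex_coords a b = \<Phi> V" "complex_coords a b \<noteq> 0"
    using complex_coords_surjective by metis
  then show thesis
    using nonparallel_if_complex_coords_nonzero circle_line_eq_span that by metis
qed

lemma lagrangian_circle: "oriented_circle V \<Longrightarrow> lagrangian (ln V)"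
  using oriented_circle_coords lagrangian_spanI by metis

lemma subspace_circle: "oriented_circle V \<Longrightarrow> subspace (ln V)"
  by (simp add: lagrangian_circle lagrangian_subspace)

lemma circle_of_line:
  assumes "nonparallel a b" "sp a b = 0"
  obtains V where "oriented_circle V" "ln V = span {a, b}" "\<Phi> V = complex_coords a b"
proof -
  obtain V where V: "\<Phi> V = complex_coords a b" using surj_ident by (metis surj_def)
  have "lie_form V V = 0"
    using complex_form_ident[of V V] complex_form_lines[OF assms(2,2)] assms(2) by (simp add: V)
  moreover have "V \<noteq> 0" using complex_coords_nonzero[OF assms] V ident_eq_0[of V] by simp
  ultimately show thesis
    using that[of V] V circle_line_eq_span[OF assms(2) V assms(1)] by (simp add: oriented_circle_def)
qed

lemma same_circle_line: "same_circle V V' \<Longrightarrow> oriented_circle V \<Longrightarrow> ln V' = ln V"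
proof -
  assume "same_circle V V'" and V: "oriented_circle V"
  then obtain k where k: "k \<noteq> 0" "V' = k *\<^sub>R V" by (auto simp: same_circle_def)
  obtain a b where ab: "nonparallel a b" "sp a b = 0" "\<Phi> V = complex_coords a b" "ln V = span {a, b}"
    using oriented_circle_coords[OF V] .
  \<comment> \<open>The factor \<open>k\<close> is absorbed into the second point of the
    line.\<close>
  have c: "\<Phi> V' = complex_coords a (k *\<^sub>R b)"
    using complex_coords_combination[of 1 a 0 b 0 k] ab(3) k linear_cmul[OF linear_ident] by simp
  have "nonparallel a (k *\<^sub>R b)"
    unfolding nonparallel_def
  proof (intro allI impI)
    fix s t assume "s *\<^sub>R a + t *\<^sub>R k *\<^sub>R b = 0"
    then have "s = 0 \<and> t * k = 0" using nonparallelD[OF ab(1), of s "t * k"] by simp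
    then show "s = 0 \<and> t = 0" using k by simp
  qed
  then have "ln V' = span {a, k *\<^sub>R b}" using circle_line_eq_span[OF _ c] ab(2) by simp
  also have "\<dots> = span {a, b}"
  proof
    show "span {a, k *\<^sub>R b} \<subseteq> span {a, b}"
      by (intro span_minimal) (simp_all add: pair_in_span span_scale)
    have "(1 / k) *\<^sub>R (k *\<^sub>R b) \<in> span {a, k *\<^sub>R b}"
      using pair_in_span span_scale by blast
    then show "span {a, b} \<subseteq> span {a, k *\<^sub>R b}"
      using k by (intro span_minimal) (simp_all add: pair_in_span)
  qed
  finally show ?thesis using ab by simp
qed

lemma same_circle_if_line_subset:
  assumes "oriented_circle V" "oriented_circle V'" "nonparallel a b"
    and "a \<in> ln V" "b \<in> ln V" "a \<in> ln V'" "b \<in> ln V'"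
  shows "same_circle V V'"
proof -
  have "\<exists>k. k \<noteq> 0 \<and> \<Phi> W = k *\<^sub>R complex_coords a b"
    if W: "oriented_circle W" "a \<in> ln W" "b \<in> ln W" for W
  proof -
    obtain p q where pq: "nonparallel p q" "sp p q = 0" "\<Phi> W = complex_coords p q" "ln W = span {p, q}"
      using oriented_circle_coords[OF W(1)] .
    then have "a \<in> span {p, q}" "b \<in> span {p, q}" using W by auto
    then obtain s t s' t' where st: "a = s *\<^sub>R p + t *\<^sub>R q" "b = s' *\<^sub>R p + t' *\<^sub>R q"
      unfolding span_pair_iff by blast
    then have e: "complex_coords a b = (s * t' - t * s') *\<^sub>R \<Phi> W"
      using complex_coords_combination pq by simp
    have "sp a b = 0" using lagrangian_isotropic[OF lagrangian_circle[OF W(1)]] W by blast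
    then have "complex_coords a b \<noteq> 0" using complex_coords_nonzero assms(3) by blast
    then have "s * t' - t * s' \<noteq> 0" using e by auto
    then have "1 / (s * t' - t * s') \<noteq> 0 \<and> \<Phi> W = (1 / (s * t' - t * s')) *\<^sub>R complex_coords a b"
      using e by simp
    then show ?thesis by blast
  qed
  then obtain k k' where k: "k \<noteq> 0" "\<Phi> V = k *\<^sub>R complex_coords a b"
    "k' \<noteq> 0" "\<Phi> V' = k' *\<^sub>R complex_coords a b"
    using assms by meson
  then have "\<Phi> V' = \<Phi> ((k' / k) *\<^sub>R V)" by (simp add: linear_cmul[OF linear_ident])
  then have "V' = (k' / k) *\<^sub>R V" using inj_ident by (simp add: inj_eq)
  then show ?thesis using k unfolding same_circle_def by (metis divide_eq_0_iff)
qed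

lemma same_circle_iff_line:
  assumes "oriented_circle V" "oriented_circle V'"
  shows "same_circle V V' \<longleftrightarrow> ln V = ln V'"
proof
  assume "ln V = ln V'"
  obtain a b where "nonparallel a b" "ln V = span {a, b}"
    using oriented_circle_coords[OF assms(1)] by metis
  then show "same_circle V V'"
    using same_circle_if_line_subset[OF assms] \<open>ln V = ln V'\<close> pair_in_span by blast
qed (use same_circle_line assms in simp)

text \<open>Both sides say that the same 2 by 2 determinant vanishes: it is the complex form of the
  two lines, and it decides whether the planes intersect.\<close>

lemma touch_iff_meet:
  assumes "oriented_circle V" "oriented_circle V'"
  shows "touch V V' \<longleftrightarrow> (\<exists>u. u \<noteq> 0 \<and> u \<in> ln V \<and> u \<in> ln V')"
proof -
  obtain a b where ab: "nonparallel a b" "sp a b = 0" "\<Phi> V = complex_coords a b" "ln V = span {a, b}"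
    using oriented_circle_coords[OF assms(1)] .
  obtain c d where cd: "nonparallel c d" "sp c d = 0" "\<Phi> V' = complex_coords c d" "ln V' = span {c, d}"
    using oriented_circle_coords[OF assms(2)] .
  have t: "touch V V' \<longleftrightarrow> sp a c * sp b d - sp a d * sp b c = 0"
    using complex_form_ident[of V V'] complex_form_lines[OF ab(2) cd(2)]
    by (simp add: touch_def ab(3) cd(3))
  show ?thesis
    using t isotropic_meets_iff[OF ab(1,2) cd(1)] ab(4) cd(4) by blast
qed

end

section \<open>Locations and turbines\<close>

text \<open>A homogeneous linear system with fewer equations than unknowns. It will produce the
  locations of contact elements and the matrix of the correlation.\<close>

lemma exists_orthogonal:
  fixes S :: "'a::euclidean_space set"
  assumes "finite S" "card S < DIM('a)"
  shows "\<exists>v. v \<noteq> 0 \<and> (\<forall>s \<in> S. inner v s = 0)"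
proof -
  have "span S \<noteq> UNIV"
  proof
    assume "span S = UNIV"
    then have "dim S = DIM('a)" by (metis dim_UNIV dim_span)
    then show False using dim_le_card'[OF assms(1)] assms(2) by simp
  qed
  then obtain v where "v \<noteq> 0" "\<And>x. x \<in> span S \<Longrightarrow> inner v x = 0"
    using span_not_UNIV_orthogonal[of S] by blast
  then show ?thesis using span_base by blast
qed

lemma point_circle_cases:
  obtains "point_circle p = (0, 0, 0, 1, 0)" "p = None"
  | x y where "point_circle p = (x, y, 1, x\<^sup>2 + y\<^sup>2, 0)" "p = Some (x, y)"
  by (cases p) auto

lemma oriented_point_circle: "oriented_circle (point_circle p)"
  by (cases p rule: point_circle_cases)
    (simp_all add: oriented_circle_def zero_prod_def power2_eq_square)

lemma point_circle_if_radius_0: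
  assumes "oriented_circle (x, y, a, b, 0)"
  shows "\<exists>p. same_circle (x, y, a, b, 0) (point_circle p)"
proof (cases "a = 0")
  case True
  then have "x * x + y * y = 0" using assms by (simp add: oriented_circle_def)
  then have "x = 0" "y = 0" by (simp_all add: sum_squares_eq_zero_iff)
  then have "b \<noteq> 0" using assms True by (auto simp: oriented_circle_def zero_prod_def)
  then have "1 / b \<noteq> 0 \<and> point_circle None = (1 / b) *\<^sub>R (x, y, a, b, 0)"
    using True \<open>x = 0\<close> \<open>y = 0\<close> by simp
  then show ?thesis unfolding same_circle_def by blast
next
  case False
  have "x * x + y * y = a * b" using assms by (simp add: oriented_circle_def)
  then have "(x / a)\<^sup>2 + (y / a)\<^sup>2 = b / a"
    using False by (simp add: power_divide add_divide_distrib[symmetric] power2_eq_square)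
  then have "1 / a \<noteq> 0 \<and> point_circle (Some (x / a, y / a)) = (1 / a) *\<^sub>R (x, y, a, b, 0)"
    using False by simp
  then show ?thesis unfolding same_circle_def by blast
qed

text \<open>On two finite points the Lie form is minus half their squared distance.\<close>

lemma touching_points_eq:
  assumes "touch (point_circle p) (point_circle q)"
  shows "p = q"
proof (cases p rule: point_circle_cases)
  case 1
  then show ?thesis using assms
    by (cases q rule: point_circle_cases) (simp_all add: touch_def)
next
  case (2 x y)
  note p = 2
  show ?thesis
  proof (cases q rule: point_circle_cases)
    case 1
    then show ?thesis using assms p by (simp add: touch_def)
  next
    case (2 x' y')
    have "(x - x') * (x - x') + (y - y') * (y - y') = 0"
      using assms p(1) 2(1) by (simp add: touch_def power2_eq_square algebra_simps)
    then show ?thesis using p 2 by (simp add: sum_squares_eq_zero_iff)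
  qed
qed

text \<open>Point circles have radius 0, so \<open>points_on W\<close> sees only the first four
  coordinates of \<open>W\<close>. Their norm \<open>lie_form W W + r * r\<close> is still positive,
  which makes the locus a real circle or line according to \<open>a\<close>.\<close>

lemma moebius_circle_points_on:
  assumes "lie_form W W > 0"
  shows "moebius_circle (points_on W)"
proof -
  obtain x y a b r where W: "W = (x, y, a, b, r)" by (metis prod.exhaust)
  have "x * x + y * y - a * b = lie_form W W + r * r" by (simp add: W)
  moreover have "r * r \<ge> 0" by simp
  ultimately have pos: "x * x + y * y - a * b > 0" using assms by linarith
  show ?thesis
  proof (cases "a = 0")
    case True
    have "points_on W = insert None (Some ` {z. inner (x, y) z = b / 2})"
    proof (intro set_eqI)
      fix p
      show "p \<in> points_on W \<longleftrightarrow> p \<in> insert None (Some ` {z. inner (x, y) z = b / 2})"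
        by (cases p rule: point_circle_cases)
          (auto simp: points_on_def touch_def W True inner_prod_def algebra_simps)
    qed
    moreover have "(x, y) \<noteq> 0" using pos True by (auto simp: zero_prod_def)
    ultimately show ?thesis unfolding moebius_circle_def by blast
  next
    case False
    \<comment> \<open>The radius obtained by completing the square in the equation of the
      locus.\<close>
    define \<rho> where "\<rho> = sqrt ((x * x + y * y - a * b) / (a * a))"
    have aa: "a * a > 0" using False by (auto simp: zero_less_mult_iff)
    then have \<rho>: "\<rho> > 0" "\<rho>\<^sup>2 = (x * x + y * y - a * b) / (a * a)"
      using pos by (simp_all add: \<rho>_def)
    have "points_on W = Some ` sphere (x / a, y / a) \<rho>"
    proof (intro set_eqI)
      fix p
      show "p \<in> points_on W \<longleftrightarrow> p \<in> Some ` sphere (x / a, y / a) \<rho>"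
      proof (cases p rule: point_circle_cases)
        case 1
        then show ?thesis using False by (auto simp: points_on_def touch_def W)
      next
        case (2 u v)
        have "(u, v) \<in> sphere (x / a, y / a) \<rho> \<longleftrightarrow> (x / a - u)\<^sup>2 + (y / a - v)\<^sup>2 = \<rho>\<^sup>2"
          using \<rho>(1) real_sqrt_unique[of \<rho> "(x / a - u)\<^sup>2 + (y / a - v)\<^sup>2"]
          by (auto simp: dist_Pair_Pair dist_real_def)
        also have "\<dots> \<longleftrightarrow> a * a * ((x / a - u)\<^sup>2 + (y / a - v)\<^sup>2) = a * a * \<rho>\<^sup>2"
          using False by simp
        also have "a * a * \<rho>\<^sup>2 = x * x + y * y - a * b" using \<rho>(2) False by simp
        also have "a * a * ((x / a - u)\<^sup>2 + (y / a - v)\<^sup>2) = (x - a * u)\<^sup>2 + (y - a * v)\<^sup>2"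
          using False by (simp add: power2_eq_square field_simps)
        also have "(x - a * u)\<^sup>2 + (y - a * v)\<^sup>2 = x * x + y * y - a * b \<longleftrightarrow>
            a * (2 * (u * x + v * y) - b - a * (u\<^sup>2 + v\<^sup>2)) = 0"
          by (auto simp: power2_eq_square algebra_simps)
        also have "\<dots> \<longleftrightarrow> 2 * (u * x + v * y) - b - a * (u\<^sup>2 + v\<^sup>2) = 0"
          using False by (simp only: mult_eq_0_iff simp_thms)
        also have "\<dots> \<longleftrightarrow> p \<in> points_on W"
          using 2 by (auto simp: points_on_def touch_def W algebra_simps)
        finally show ?thesis using 2(2) by auto
      qed
    qed
    then show ?thesis using \<rho>(1) unfolding moebius_circle_def by blast
  qed
qed

context lie_model
begin

section \<open>Contact elements and their locations\<close>

lemma touch_if_common_point: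
  "oriented_circle V \<Longrightarrow> oriented_circle W \<Longrightarrow> u \<noteq> 0 \<Longrightarrow> u \<in> ln V \<Longrightarrow> u \<in> ln W \<Longrightarrow> touch V W"
  using touch_iff_meet by blast

lemma touching_circles_meet:
  assumes "oriented_circle V" "oriented_circle W" "touch V W"
  obtains u where "u \<noteq> 0" "u \<in> ln V" "u \<in> ln W"
  using touch_iff_meet assms by blast

lemma generated_byI:
  assumes "oriented_circle V" "oriented_circle W" "\<not> same_circle V W"
    and "u \<noteq> 0" "u \<in> ln V" "u \<in> ln W"
  shows "generated_by \<Phi> u V W"
  using lagrangian_inter[of "ln V" "ln W" u] assms lagrangian_circle same_circle_iff_line
  by (simp add: generated_by_def)

lemma generated_byD:
  assumes "generated_by \<Phi> u V W"
  shows "u \<noteq> 0" "u \<in> ln V" "u \<in> ln W"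
  using assms span_base[of u "{u}"] by (auto simp: generated_by_def)

text \<open>For fixed \<open>\<alpha>\<close> the radius coordinate of the line through
  \<open>\<alpha>\<close> and \<open>\<beta>\<close> is linear in \<open>\<beta>\<close>, and so is
  the condition of the complex. A third condition, Euclidean orthogonality to
  \<open>\<alpha>\<close>, keeps \<open>\<beta>\<close> independent of \<open>\<alpha>\<close>;
  three conditions in dimension four have a nonzero solution.\<close>

lemma exists_location:
  assumes "\<alpha> \<noteq> 0"
  shows "\<exists>p. located \<Phi> \<alpha> p"
proof -
  define \<Psi> where "\<Psi> = inv \<Phi>"
  have lin: "linear \<Psi>"
    unfolding \<Psi>_def using linear_ident inj_ident
    by (simp add: inj_linear_imp_inv_linear surj_ident bij_def)
  have inv: "\<Phi> (\<Psi> g) = g" for g by (simp add: \<Psi>_def surj_ident surj_f_inv_f)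
  define rad :: "lvec \<Rightarrow> real" where "rad V = snd (snd (snd (snd V)))" for V
  have radlin: "linear rad" by (rule linearI) (simp_all add: rad_def)
  have cclin: "linear (complex_coords \<alpha>)"
    by (rule linearI) (simp_all add: complex_coords_def pluecker_def algebra_simps)
  define f where "f = rad \<circ> \<Psi> \<circ> complex_coords \<alpha>"
  have f: "linear f" unfolding f_def by (intro linear_compose radlin lin cclin)
  have g: "linear (sp \<alpha>)" by (rule linearI) simp_all
  have "finite {\<alpha>, adjoint f 1, adjoint (sp \<alpha>) 1}" by simp
  moreover have "card {\<alpha>, adjoint f 1, adjoint (sp \<alpha>) 1} \<le> 3"
    using card_length[of "[\<alpha>, adjoint f 1, adjoint (sp \<alpha>) 1]"] by simp
  then have "card {\<alpha>, adjoint f 1, adjoint (sp \<alpha>) 1} < DIM(real^4)" by simp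
  ultimately obtain \<beta> where \<beta>: "\<beta> \<noteq> 0" "inner \<beta> \<alpha> = 0" "inner \<beta> (adjoint f 1) = 0"
    "inner \<beta> (adjoint (sp \<alpha>) 1) = 0"
    using exists_orthogonal by (metis insertCI)
  have fb: "f \<beta> = 0" "sp \<alpha> \<beta> = 0"
    using \<beta>(3,4) adjoint_works[OF f, of \<beta> 1] adjoint_works[OF g, of \<beta> 1] by simp_all
  have "\<beta> \<notin> span {\<alpha>}"
  proof
    assume "\<beta> \<in> span {\<alpha>}"
    then obtain k where "\<beta> = k *\<^sub>R \<alpha>" by (auto simp: span_singleton)
    then show False using \<beta>(1,2) by auto
  qed
  then have np: "nonparallel \<alpha> \<beta>" using nonparallelI assms by blast
  obtain V where V: "oriented_circle V" "ln V = span {\<alpha>, \<beta>}" "\<Phi> V = complex_coords \<alpha> \<beta>"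
    using circle_of_line[OF np fb(2)] .
  have "rad V = f \<beta>"
    using V(3) inv_f_f[OF inj_ident, of V] by (simp add: f_def \<Psi>_def)
  then obtain x y a b where xy: "V = (x, y, a, b, 0)"
    using fb(1) by (cases V) (auto simp: rad_def)
  then obtain p where p: "same_circle V (point_circle p)"
    using point_circle_if_radius_0 V(1) by blast
  then have "\<alpha> \<in> ln (point_circle p)" using same_circle_line[OF p V(1)] V(2) pair_in_span by auto
  then show ?thesis
    using oriented_point_circle unfolding located_def contact_element_def by blast
qed

lemma located_iff: "located \<Phi> \<alpha> p \<longleftrightarrow> \<alpha> \<in> ln (point_circle p)"
  by (simp add: located_def contact_element_def oriented_point_circle)

lemma location_unique: "\<alpha> \<noteq> 0 \<Longrightarrow> located \<Phi> \<alpha> p \<Longrightarrow> located \<Phi> \<alpha> q \<Longrightarrow> p = q"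
  using touching_points_eq touch_if_common_point oriented_point_circle located_iff by blast

lemma circle_through_perp:
  assumes "\<alpha> \<noteq> 0" "\<beta> \<noteq> 0" "sp \<alpha> \<beta> = 0"
  obtains V where "oriented_circle V" "\<alpha> \<in> ln V" "\<beta> \<in> ln V"
proof (cases "nonparallel \<alpha> \<beta>")
  case True
  then show thesis using circle_of_line[OF True assms(3)] pair_in_span that by metis
next
  case False
  \<comment> \<open>For one and the same contact element any of its circles serves, and its location
    is one of them.\<close>
  then have "\<beta> \<in> span {\<alpha>}" using not_nonparallel assms by blast
  moreover obtain p where "\<alpha> \<in> ln (point_circle p)"
    using exists_location assms located_iff by blast
  ultimately show thesis
    using that oriented_point_circle subspace_circle in_subspace_if_parallel by blast
qed

section \<open>Turbines and the circles that represent them\<close>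

definition turbine_points :: "real^4 \<Rightarrow> real^4 \<Rightarrow> mpoint set" where
  "turbine_points \<alpha> \<beta> = {p. \<exists>\<gamma> \<in> turbine \<alpha> \<beta>. \<gamma> \<noteq> 0 \<and> located \<Phi> \<gamma> p}"

text \<open>The vector \<open>W\<close> with coordinates
  \<open>turbine_coords \<alpha> \<beta>\<close> touches exactly the points whose lines meet the
  turbine, and its norm is positive because the turbine lies outside the complex.\<close>

lemma represents_turbine_points:
  assumes "sp \<alpha> \<beta> \<noteq> 0"
  shows "represents_turbine \<Phi> (turbine_points \<alpha> \<beta>) \<alpha> \<beta>"
proof -
  obtain W where W: "\<Phi> W = turbine_coords \<alpha> \<beta>" using surj_ident by (metis surj_def)
  have "p \<in> turbine_points \<alpha> \<beta> \<longleftrightarrow> p \<in> points_on W" for p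
  proof -
    obtain a b where ab: "nonparallel a b" "sp a b = 0" "\<Phi> (point_circle p) = complex_coords a b"
      "ln (point_circle p) = span {a, b}"
      using oriented_circle_coords[OF oriented_point_circle] .
    have "p \<in> turbine_points \<alpha> \<beta> \<longleftrightarrow> (\<exists>u. u \<noteq> 0 \<and> u \<in> span {a, b} \<and> u \<in> span {\<alpha>, \<beta>})"
      using ab(4) by (auto simp: turbine_points_def turbine_def located_iff)
    also have "\<dots> \<longleftrightarrow> sp a \<alpha> * sp b \<beta> - sp a \<beta> * sp b \<alpha> = 0"
      using isotropic_meets_iff[OF ab(1,2) nonparallel_if_sp[OF assms]] .
    also have "\<dots> \<longleftrightarrow> p \<in> points_on W"
      using complex_form_ident[of "point_circle p" W] complex_form_turbine[OF ab(2), of \<alpha> \<beta>]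
      by (simp add: points_on_def touch_def ab(3) W)
    finally show ?thesis .
  qed
  then have eq: "turbine_points \<alpha> \<beta> = points_on W" by blast
  have "lie_form W W = (sp \<alpha> \<beta>)\<^sup>2 / 2"
    using complex_form_ident[of W W] complex_form_turbine_self[of \<alpha> \<beta>] by (simp add: W)
  moreover have "(sp \<alpha> \<beta>)\<^sup>2 > 0" using assms by simp
  ultimately have "lie_form W W > 0" by linarith
  then have "moebius_circle (turbine_points \<alpha> \<beta>)" using eq moebius_circle_points_on by simp
  then show ?thesis
    using assms turbine_points_def by (simp add: represents_turbine_def in_complex_iff_sp)
qed

lemma turbine_points_subset_polar:
  assumes "sp a' b' \<noteq> 0"
    and "sp a a' = 0" "sp a b' = 0" "sp b a' = 0" "sp b b' = 0"
  shows "turbine_points a b \<subseteq> turbine_points a' b'"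
proof
  fix p assume "p \<in> turbine_points a b"
  then obtain v where v: "v \<in> ln (point_circle p)" "v \<noteq> 0" "v \<in> span {a, b}"
    by (auto simp: turbine_points_def turbine_def located_iff)
  show "p \<in> turbine_points a' b'"
    using lagrangian_meets_polar[OF lagrangian_circle[OF oriented_point_circle] v assms]
    by (auto simp: turbine_points_def turbine_def located_iff)
qed

text \<open>A line of the complex meets both of two polar lines or neither. Hence one auxiliary
  circle can represent two turbines.\<close>

lemma turbine_points_polar:
  assumes "sp a b \<noteq> 0" "sp a' b' \<noteq> 0"
    and "sp a a' = 0" "sp a b' = 0" "sp b a' = 0" "sp b b' = 0"
  shows "turbine_points a b = turbine_points a' b'"
  using turbine_points_subset_polar[of a' b' a b] turbine_points_subset_polar[of a b a' b'] assms
    sp_commute_zero by blast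

end

section \<open>The combinatorial cube\<close>

text \<open>What the construction needs from general position, stated by touching alone: no two
  non-adjacent sides of the hexagon touch.\<close>

definition generic_hexagon :: "(3 \<Rightarrow> lvec) \<Rightarrow> (3 \<Rightarrow> 3 \<Rightarrow> lvec) \<Rightarrow> bool" where
  "generic_hexagon cl clm \<longleftrightarrow> touching_hexagon cl clm \<and>
     (\<forall>l m n. distinct [l, m, n] \<longrightarrow>
        \<not> touch (cl l) (cl m) \<and> \<not> touch (clm l m) (clm m n) \<and> \<not> touch (cl l) (clm m n))"

lemma third_index:
  assumes "l \<noteq> (m :: 3)"
  obtains n where "distinct [l, m, n]"
proof -
  have "\<exists>n. distinct [l, m, n]"
    using assms exhaust_3[of l] exhaust_3[of m]
    by (auto intro: exI[of _ 1] exI[of _ 2] exI[of _ 3])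
  then show thesis using that by blast
qed

lemma other_indices: "\<exists>m n. distinct [l :: 3, m, n]"
proof -
  have "\<exists>m. l \<noteq> m"
    using exhaust_3[of l] by (auto intro: exI[of _ 1] exI[of _ 2])
  then show ?thesis using third_index by metis
qed

lemma distinct3D:
  "distinct [l, m, n] \<Longrightarrow> l \<noteq> m \<and> m \<noteq> l \<and> l \<noteq> n \<and> n \<noteq> l \<and> m \<noteq> n \<and> n \<noteq> m"
  by auto

lemma other_indices_unique:
  assumes "distinct [l :: 3, m, n]" "distinct [l, m', n']"
  shows "m' = m \<and> n' = n \<or> m' = n \<and> n' = m"
  using assms exhaust_3[of l] exhaust_3[of m] exhaust_3[of n] exhaust_3[of m'] exhaust_3[of n']
  by auto

text \<open>The contact points are only required to be nonzero common vectors; that they span the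
  intersections follows from genericity in \<open>generated_C\<close> and
  \<open>generated_Y\<close>.\<close>

locale cube_contacts = lie_model \<Phi> for \<Phi> +
  fixes c :: lvec and cl :: "3 \<Rightarrow> lvec" and clm :: "3 \<Rightarrow> 3 \<Rightarrow> lvec"
    and C :: "3 \<Rightarrow> real^4" and Y :: "3 \<Rightarrow> 3 \<Rightarrow> real^4"
  assumes generic: "generic_hexagon cl clm"
    and oriented_c: "oriented_circle c" and touch_c: "touch c (cl l)"
    and C: "C l \<noteq> 0" "C l \<in> ln c" "C l \<in> ln (cl l)"
    and Y: "l \<noteq> m \<Longrightarrow> Y l m \<noteq> 0" "l \<noteq> m \<Longrightarrow> Y l m \<in> ln (cl m)"
      "l \<noteq> m \<Longrightarrow> Y l m \<in> ln (clm l m)"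
begin

lemma oriented_cl: "oriented_circle (cl l)"
  using generic by (simp add: generic_hexagon_def touching_hexagon_def)

lemma hexagon_edge:
  assumes "l \<noteq> m"
  shows "oriented_circle (clm l m)" "clm m l = clm l m" "touch (cl l) (clm l m)"
  using generic assms by (metis generic_hexagon_def touching_hexagon_def)+

lemma lagrangian_c: "lagrangian (ln c)" "lagrangian (ln (cl l))"
  "l \<noteq> m \<Longrightarrow> lagrangian (ln (clm l m))"
  by (simp_all add: lagrangian_circle oriented_c oriented_cl hexagon_edge)

lemma disjoint_cl: "l \<noteq> m \<Longrightarrow> u \<in> ln (cl l) \<Longrightarrow> u \<in> ln (cl m) \<Longrightarrow> u = 0"
  using third_index[of l m] touch_if_common_point[OF oriented_cl oriented_cl] generic
  unfolding generic_hexagon_def by metis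

lemma disjoint_clm:
  "distinct [l, m, n] \<Longrightarrow> u \<in> ln (clm l m) \<Longrightarrow> u \<in> ln (clm m n) \<Longrightarrow> u = 0"
  using touch_if_common_point[OF hexagon_edge(1) hexagon_edge(1)] generic
  unfolding generic_hexagon_def by (metis distinct_length_2_or_more)

lemma disjoint_opposite:
  "distinct [l, m, n] \<Longrightarrow> u \<in> ln (cl l) \<Longrightarrow> u \<in> ln (clm m n) \<Longrightarrow> u = 0"
  using touch_if_common_point[OF oriented_cl hexagon_edge(1)] generic
  unfolding generic_hexagon_def by (metis distinct_length_2_or_more)

lemma perp_CC: "sp (C l) (C m) = 0"
  using lagrangian_isotropic[OF lagrangian_c(1)] C by blast

lemma perp_CY: "l \<noteq> m \<Longrightarrow> sp (C m) (Y l m) = 0"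
  using lagrangian_isotropic[OF lagrangian_c(2)] C Y by blast

lemma perp_YY_cl: "l \<noteq> m \<Longrightarrow> n \<noteq> m \<Longrightarrow> sp (Y l m) (Y n m) = 0"
  using lagrangian_isotropic[OF lagrangian_c(2)] Y by blast

lemma perp_YY_clm: "l \<noteq> m \<Longrightarrow> sp (Y l m) (Y m l) = 0"
  using lagrangian_isotropic[OF lagrangian_c(3)] Y hexagon_edge(2) by metis

text \<open>If the two contact points on \<open>c\<^sub>m\<close> coincided, the neighbouring sides
  of the hexagon would meet there.\<close>

lemma nonparallel_Y_cl:
  assumes "distinct [l, m, n]"
  shows "nonparallel (Y l m) (Y n m)"
proof (rule ccontr)
  assume "\<not> ?thesis"
  then have "Y n m \<in> span {Y l m}" using not_nonparallel Y assms by auto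
  then have "Y n m \<in> ln (clm l m)"
    using assms by (auto intro: in_subspace_if_parallel[OF subspace_circle] hexagon_edge(1) Y(3))
  moreover have "Y n m \<in> ln (clm m n)" using distinct3D[OF assms] Y(3)[of n m] hexagon_edge(2)[of m n] by simp
  ultimately show False using disjoint_clm assms Y(1)[of n m] by auto
qed

lemma nonparallel_Y_clm:
  assumes "l \<noteq> m"
  shows "nonparallel (Y l m) (Y m l)"
proof (rule ccontr)
  assume "\<not> ?thesis"
  then have "Y m l \<in> span {Y l m}" using not_nonparallel Y assms by auto
  then have "Y m l \<in> ln (cl m)"
    using assms by (auto intro: in_subspace_if_parallel[OF subspace_circle] oriented_cl Y(2))
  then show False using disjoint_cl[OF assms, of "Y m l"] Y[of m l] assms by auto
qed

lemma nonparallel_C: "l \<noteq> m \<Longrightarrow> nonparallel (C l) (C m)"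
  using not_nonparallel in_subspace_if_parallel[OF subspace_circle[OF oriented_cl]] C disjoint_cl
  by metis

lemma cl_span:
  assumes d: "distinct [l, m, n]"
  shows "ln (cl m) = span {Y l m, Y n m}"
  by (rule lagrangian_eq_span[OF lagrangian_c(2) nonparallel_Y_cl[OF d]])
    (use Y(2) distinct3D[OF d] in auto)

lemma c_span: "l \<noteq> m \<Longrightarrow> ln c = span {C l, C m}"
  by (rule lagrangian_eq_span[OF lagrangian_c(1) nonparallel_C]) (auto simp: C)

lemma clm_span:
  assumes "l \<noteq> m"
  shows "ln (clm l m) = span {Y l m, Y m l}"
  by (rule lagrangian_eq_span[OF lagrangian_c(3) nonparallel_Y_clm])
    (use Y(3)[of m l] Y(3)[of l m] hexagon_edge(2) assms in auto)

text \<open>\<open>Y m n\<close> is orthogonal to \<open>Y n m\<close>; were it also orthogonal to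
  \<open>Y l m\<close>, it would lie on the line of \<open>c\<^sub>m\<close>, which would then meet
  that of \<open>c\<^sub>n\<close>.\<close>

lemma nonperp_YY:
  assumes "distinct [l, m, n]"
  shows "sp (Y l m) (Y m n) \<noteq> 0"
proof
  assume 1: "sp (Y l m) (Y m n) = 0"
  have 2: "sp (Y n m) (Y m n) = 0" using perp_YY_clm distinct3D[OF assms] by simp
  have "Y m n \<in> ln (cl m)"
    by (rule lagrangian_in[OF lagrangian_c(2) nonparallel_Y_cl[OF assms] _ _ 1 2])
      (use Y(2) distinct3D[OF assms] in auto)
  then show False using disjoint_cl[of m n "Y m n"] Y(1,2)[of m n] assms by simp
qed

text \<open>Orthogonality would force \<open>C l\<close> and \<open>C m\<close> to coincide with
  \<open>Y m l\<close> and \<open>Y l m\<close>. Then the line of \<open>c\<close> would be that of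
  \<open>c\<^sub>l\<^sub>m\<close>, and \<open>C n\<close> would lie on this side and on the
  opposite side \<open>c\<^sub>n\<close>.\<close>

lemma nonperp_CY:
  assumes "l \<noteq> m"
  shows "sp (C l) (Y l m) \<noteq> 0"
proof
  assume 0: "sp (C l) (Y l m) = 0"
  obtain n where d: "distinct [l, m, n]" using third_index assms .
  then have d': "distinct [m, l, n]" "distinct [n, l, m]" "distinct [n, m, l]" by auto
  obtain s t where Cl: "C l = s *\<^sub>R Y m l + t *\<^sub>R Y n l"
    using C(3)[of l] cl_span[OF d'(1)] span_pair_iff by metis
  \<comment> \<open>Of the two vertices on the line of \<open>c\<^sub>l\<close>,
    \<open>Y m l\<close> is orthogonal to \<open>Y l m\<close> and \<open>Y n l\<close> is
    not.\<close>
  have "t = 0"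
    using 0 perp_YY_clm[of m l] nonperp_YY[OF d'(2)] assms by (simp add: Cl)
  then have Cl: "C l = s *\<^sub>R Y m l" "s \<noteq> 0" using Cl C(1)[of l] by auto
  obtain s' t' where Cm: "C m = s' *\<^sub>R Y l m + t' *\<^sub>R Y n m"
    using C(3)[of m] cl_span[OF d] span_pair_iff by metis
  have "sp (Y m l) (C m) = 0" using perp_CC[of l m] Cl by simp
  then have "t' = 0"
    using perp_YY_clm[of m l] nonperp_YY[OF d'(3)] sp_commute_zero assms by (auto simp: Cm)
  then have Cm: "C m = s' *\<^sub>R Y l m" "s' \<noteq> 0" using Cm C(1)[of m] by auto
  have "sp (Y l m) (C n) = 0" "sp (Y m l) (C n) = 0"
    using perp_CC[of l n] perp_CC[of m n] Cl Cm by simp_all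
  moreover have "Y m l \<in> ln (clm l m)" using Y(3)[of m l] hexagon_edge(2) assms by simp
  ultimately have "C n \<in> ln (clm l m)"
    using lagrangian_in[OF lagrangian_c(3) nonparallel_Y_clm] Y(3) assms by blast
  then show False using disjoint_opposite[of n l m] C d by auto
qed

text \<open>\<open>C m\<close> is a combination of \<open>C l\<close> and \<open>C n\<close> on the
  line of \<open>c\<close>, and of \<open>Y l m\<close> and \<open>Y n m\<close> on the line of
  \<open>c\<^sub>m\<close>. Equating the two and collecting the terms of \<open>l\<close> and of
  \<open>n\<close> on different sides gives a common vector of the two turbines.\<close>

lemma exists_D:
  "\<exists>D. D \<noteq> 0 \<and> (\<forall>l n. distinct [l, m, n] \<longrightarrow>
     turbine (C l) (Y l m) \<inter> turbine (C n) (Y n m) = span {D})"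
proof -
  obtain l n where d0: "distinct [m, l, n]" using other_indices by blast
  then have d: "distinct [l, m, n]" by auto
  obtain p q where pq: "C m = p *\<^sub>R C l + q *\<^sub>R C n"
    using C(2)[of m] c_span[of l n] span_pair_iff d by auto
  obtain a b where ab: "C m = a *\<^sub>R Y l m + b *\<^sub>R Y n m"
    using C(3)[of m] cl_span[OF d] span_pair_iff by metis
  define D where "D = p *\<^sub>R C l - a *\<^sub>R Y l m"
  have D': "D = b *\<^sub>R Y n m - q *\<^sub>R C n"
    using pq ab by (simp add: D_def algebra_simps)
  have "D \<noteq> 0"
  proof
    assume "D = 0"
    then have "sp (C l) D = 0" by simp
    then have "a = 0" using nonperp_CY[of l m] d by (simp add: D_def)
    then have Cm: "C m = b *\<^sub>R Y n m" "b \<noteq> 0" using ab C(1)[of m] by auto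
    then show False using perp_CC[of n m] nonperp_CY[of n m] distinct3D[OF d] by simp
  qed
  have I: "turbine (C l) (Y l m) \<inter> turbine (C n) (Y n m) = span {D}"
    unfolding turbine_def
  proof (rule span_pair_inter)
    show "C l \<notin> span {C n, Y n m}"
    proof
      assume "C l \<in> span {C n, Y n m}"
      then obtain s t where st: "C l = s *\<^sub>R C n + t *\<^sub>R Y n m" using span_pair_iff by blast
      have "sp (C n) (C l) = 0" by (rule perp_CC)
      then have "t = 0" using nonperp_CY[of n m] distinct3D[OF d] by (simp add: st)
      then have "1 *\<^sub>R C l = s *\<^sub>R C n" using st by simp
      moreover have "nonparallel (C l) (C n)" using nonparallel_C d by simp
      ultimately show False using nonparallel_eqD by fastforce
    qed
    show "D \<in> span {C l, Y l m}"
      unfolding D_def by (simp add: pair_in_span span_diff span_scale)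
    show "D \<in> span {C n, Y n m}"
      unfolding D' by (simp add: pair_in_span span_diff span_scale)
  qed (use \<open>D \<noteq> 0\<close> in simp_all)
  have "turbine (C l') (Y l' m) \<inter> turbine (C n') (Y n' m) = span {D}"
    if d1: "distinct [l', m, n']" for l' n'
  proof -
    have "distinct [m, l', n']" using d1 by auto
    then consider "l' = l" "n' = n" | "l' = n" "n' = l" using other_indices_unique[OF d0] by blast
    then show ?thesis using I by cases (simp_all add: Int_commute)
  qed
  then show ?thesis using \<open>D \<noteq> 0\<close> by blast
qed

end

section \<open>Orthogonality relations of the shared contact elements\<close>

locale cube_turbines = cube_contacts \<Phi> c cl clm C Y for \<Phi> c cl clm C Y +
  fixes D :: "3 \<Rightarrow> real^4"
  assumes D_nonzero: "D m \<noteq> 0"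
    and D_inter: "distinct [l, m, n] \<Longrightarrow>
      turbine (C l) (Y l m) \<inter> turbine (C n) (Y n m) = span {D m}"
begin

lemma D_in_turbine:
  assumes "l \<noteq> m"
  shows "D m \<in> span {C l, Y l m}"
proof -
  obtain n where "distinct [l, m, n]" using third_index assms .
  then show ?thesis using D_inter[of l m n] span_base[of "D m" "{D m}"] by (auto simp: turbine_def)
qed

lemma perp_DC: "sp (D l) (C l) = 0"
proof -
  obtain m n where "distinct [l, m, n]" using other_indices by blast
  then show ?thesis
    using sp_span_pair(2)[OF D_in_turbine[of m l]] perp_CC perp_CY by auto
qed

lemma perp_DY: "l \<noteq> m \<Longrightarrow> sp (D l) (Y l m) = 0"
  using sp_span_pair(2)[OF D_in_turbine[of m l], of "Y l m"] perp_CY[of l m] perp_YY_clm[of l m]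
    sp_commute_zero by auto

lemma perp_YD: "l \<noteq> m \<Longrightarrow> sp (Y l m) (D l) = 0"
  using perp_DY sp_commute_zero by blast

lemma perp_DD: "sp (D l) (D m) = 0"
  using sp_span_pair(1)[OF D_in_turbine[of l m], of "D l"] perp_DC perp_DY[of l m]
  by (cases "l = m") auto

text \<open>Orthogonality would reduce \<open>D l\<close> to a multiple of \<open>C n\<close> in one
  of its turbines, and then to a multiple of \<open>C m\<close> in the other.\<close>

lemma nonperp_DY:
  assumes d: "distinct [l, m, n]"
  shows "sp (D l) (Y m n) \<noteq> 0"
proof
  assume 0: "sp (D l) (Y m n) = 0"
  obtain s t where D: "D l = s *\<^sub>R C n + t *\<^sub>R Y n l"
    using D_in_turbine[of n l] d span_pair_iff by auto
  have "sp (Y n l) (Y m n) \<noteq> 0" using nonperp_YY[of m n l] sp_commute_zero d by auto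
  then have "t = 0" using 0 perp_CY[of m n] d by (simp add: D)
  then have D: "D l = s *\<^sub>R C n" "s \<noteq> 0" using D D_nonzero[of l] by auto
  obtain s' t' where D': "D l = s' *\<^sub>R C m + t' *\<^sub>R Y m l"
    using D_in_turbine[of m l] d span_pair_iff by auto
  have "sp (C m) (D l) = 0" using D(1) perp_CC by simp
  then have "t' = 0" using nonperp_CY[of m l] distinct3D[OF d] by (simp add: D')
  then have "s *\<^sub>R C n = s' *\<^sub>R C m" using D D' by simp
  moreover have "nonparallel (C n) (C m)" using nonparallel_C distinct3D[OF d] by simp
  ultimately show False using nonparallel_eqD D(2) by blast
qed

text \<open>The lines of \<open>\<T>\<^sup>l\<^sup>,\<^sup>m\<close> and \<open>\<T>\<^sup>m\<^sup>,\<^sup>l\<close> are polar to each other, and so are those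
  of \<open>\<T>\<^sup>l\<^sup>,\<^sup>m\<^sub>n\<close> and \<open>\<T>\<^sup>m\<^sup>,\<^sup>l\<^sub>n\<close>.\<close>

lemma in_turbine_if_perp:
  assumes "l \<noteq> m" "sp v (C m) = 0" "sp v (Y m l) = 0"
  shows "v \<in> span {C l, Y l m}"
  by (rule polar_span[OF nonperp_CY nonperp_CY _ _ _ _ assms(2,3)])
    (use assms(1) perp_CC perp_CY[of m l] perp_CY[of l m] perp_YY_clm[of l m] sp_commute_zero in auto)

lemma in_turbine_sub_if_perp:
  assumes "distinct [l, m, n]" "sp v (Y m n) = 0" "sp v (D l) = 0"
  shows "v \<in> span {Y l n, D m}"
  by (rule polar_span[OF _ _ _ _ _ _ assms(2,3)])
    (use assms(1) nonperp_DY[of m l n] nonperp_DY[of l m n] perp_YY_cl[of l n m] perp_DY[of l n]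
      perp_DY[of m n] perp_DD sp_commute_zero in auto)

text \<open>By polarity, orthogonality to \<open>C l\<close> and \<open>Y l m\<close> is membership
  in the turbine of \<open>C m\<close> and \<open>Y m l\<close>, and likewise with \<open>n\<close>;
  the two turbines share only \<open>D l\<close>.\<close>

lemma D_unique:
  assumes "distinct [l, m, n]" "sp v (C l) = 0" "sp v (Y l m) = 0" "sp v (Y l n) = 0"
  shows "v \<in> span {D l}"
  using D_inter[of m l n] in_turbine_if_perp[of m l v] in_turbine_if_perp[of n l v] assms
  by (auto simp: turbine_def)

text \<open>On the line of \<open>c\<^sub>m\<^sub>n\<close> orthogonality to \<open>D l\<close>
  singles out one point. As this point is also orthogonal to both vertices of that line, polarity
  places it in both turbines.\<close>

lemma exists_E:
  "\<exists>e. e \<noteq> 0 \<and> (\<forall>m n. distinct [l, m, n] \<longrightarrow> e \<in> ln (clm m n) \<and>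
     turbine (Y l n) (D m) \<inter> turbine (Y l m) (D n) = span {e})"
proof -
  obtain m n where d: "distinct [l, m, n]" using other_indices by blast
  then have d': "distinct [l, n, m]" by auto
  \<comment> \<open>The coefficients solve \<open>sp e (D l) = 0\<close>.\<close>
  define e where "e = sp (Y n m) (D l) *\<^sub>R Y m n - sp (Y m n) (D l) *\<^sub>R Y n m"
  have nz: "sp (Y n m) (D l) \<noteq> 0"
    using nonperp_DY[OF d'] sp_commute_zero by blast
  have "e \<noteq> 0"
  proof
    assume "e = 0"
    then have "sp (Y n m) (D l) *\<^sub>R Y m n + (- sp (Y m n) (D l)) *\<^sub>R Y n m = 0"
      by (simp add: e_def)
    moreover have "nonparallel (Y m n) (Y n m)" using nonparallel_Y_clm d by simp
    ultimately have "sp (Y n m) (D l) = 0" using nonparallelD by blast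
    then show False using nz by simp
  qed
  moreover have e: "e \<in> ln (clm m n)"
    using clm_span[of m n] d by (simp add: e_def pair_in_span span_diff span_scale)
  moreover have "sp e (D l) = 0" by (simp add: e_def)
  moreover have "sp e (Y m n) = 0" "sp e (Y n m) = 0"
    using perp_YY_clm[of m n] perp_YY_clm[of n m] distinct3D[OF d] by (simp_all add: e_def)
  ultimately have "e \<in> span {Y l n, D m}" "e \<in> span {Y l m, D n}"
    using in_turbine_sub_if_perp[OF d] in_turbine_sub_if_perp[OF d'] by blast+
  \<comment> \<open>\<open>Y n m\<close> separates the two: it is orthogonal to the whole plane, but
    not to \<open>Y l n\<close>.\<close>
  moreover have "Y l n \<notin> span {Y l m, D n}"
  proof
    assume "Y l n \<in> span {Y l m, D n}"
    moreover have "sp (Y n m) (Y l m) = 0" "sp (Y n m) (D n) = 0"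
      using perp_YY_cl perp_YD distinct3D[OF d] by simp_all
    ultimately have "sp (Y n m) (Y l n) = 0" using sp_span_pair(1) by blast
    then show False using nonperp_YY[OF d'] sp_commute_zero by blast
  qed
  ultimately have I: "turbine (Y l n) (D m) \<inter> turbine (Y l m) (D n) = span {e}"
    unfolding turbine_def using \<open>e \<noteq> 0\<close> by (intro span_pair_inter) simp_all
  have "e \<in> ln (clm m' n') \<and> turbine (Y l n') (D m') \<inter> turbine (Y l m') (D n') = span {e}"
    if d1: "distinct [l, m', n']" for m' n'
  proof -
    have clm: "clm n m = clm m n" using hexagon_edge(2) d by simp
    consider "m' = m" "n' = n" | "m' = n" "n' = m" using other_indices_unique[OF d d1] by blast
    then show ?thesis using I e by cases (simp_all add: Int_commute clm)
  qed
  then show ?thesis using \<open>e \<noteq> 0\<close> by blast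
qed

end

locale cube_points = cube_turbines \<Phi> c cl clm C Y D for \<Phi> c cl clm C Y D +
  fixes E :: "3 \<Rightarrow> 3 \<Rightarrow> 3 \<Rightarrow> real^4"
  assumes E_nonzero: "distinct [l, m, n] \<Longrightarrow> E l m n \<noteq> 0"
    and E_clm: "distinct [l, m, n] \<Longrightarrow> E l m n \<in> ln (clm m n)"
    and E_inter: "distinct [l, m, n] \<Longrightarrow>
      turbine (Y l n) (D m) \<inter> turbine (Y l m) (D n) = span {E l m n}"
begin

lemma E_in_turbine: "distinct [l, m, n] \<Longrightarrow> E l m n \<in> span {Y l n, D m}"
  using E_inter[of l m n] span_base[of "E l m n" "{E l m n}"] by (auto simp: turbine_def)

lemma perp_ED:
  assumes "distinct [l, m, n]"
  shows "sp (E l m n) (D l) = 0"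
proof (rule sp_span_pair(2)[OF E_in_turbine[OF assms]])
  show "sp (D l) (Y l n) = 0" using perp_DY assms by simp
qed (rule perp_DD)

lemma E_unique:
  assumes d: "distinct [l, m, n]" and v: "v \<in> ln (clm m n)" "sp v (D l) = 0"
  shows "v \<in> span {E l m n}"
proof -
  have "lagrangian (ln (clm m n))" "Y m n \<in> ln (clm m n)" "Y n m \<in> ln (clm m n)"
    using lagrangian_c(3)[of m n] Y(3)[of m n] Y(3)[of n m] hexagon_edge(2)[of m n]
      distinct3D[OF d] by simp_all
  then have "sp v (Y m n) = 0" "sp v (Y n m) = 0" using lagrangian_isotropic v by blast+
  then show ?thesis
    using in_turbine_sub_if_perp[of l m n v] in_turbine_sub_if_perp[of l n m v] d v
      E_inter[OF d] by (auto simp: turbine_def)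
qed

text \<open>\<open>E m l n\<close> is a combination of \<open>Y m n\<close> and \<open>D l\<close>,
  and each is orthogonal to \<open>E l m n\<close>: the former because it is orthogonal to
  \<open>Y l n\<close> and \<open>D m\<close>, which span a turbine through \<open>E l m n\<close>,
  the latter by \<open>perp_ED\<close>.\<close>

lemma perp_EE:
  assumes d: "distinct [l, m, n]"
  shows "sp (E l m n) (E m l n) = 0"
proof -
  have E: "E m l n \<in> span {Y m n, D l}" using E_in_turbine d by auto
  have "sp (Y m n) (Y l n) = 0" "sp (Y m n) (D m) = 0"
    using perp_YY_cl perp_YD distinct3D[OF d] by simp_all
  then have "sp (Y m n) (E l m n) = 0" using sp_span_pair(1)[OF E_in_turbine[OF d]] by blast
  moreover have "sp (D l) (E l m n) = 0" using perp_ED[OF d] sp_commute_zero by blast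
  ultimately show ?thesis using sp_span_pair(1)[OF E] sp_commute_zero by blast
qed

text \<open>A coincidence would be a common point of two non-adjacent sides.\<close>

lemma nonparallel_E:
  assumes d: "distinct [l, m, n]"
  shows "nonparallel (E l m n) (E m l n)"
proof (rule ccontr)
  assume "\<not> ?thesis"
  then have "E m l n \<in> span {E l m n}" using not_nonparallel E_nonzero[OF d] by blast
  then have "E m l n \<in> ln (clm m n)"
    using in_subspace_if_parallel[OF subspace_circle E_clm[OF d]] hexagon_edge(1) d by auto
  moreover have "E m l n \<in> ln (clm l n)" "E m l n \<noteq> 0" using E_clm E_nonzero d by auto
  ultimately show False
    using disjoint_clm[of m n l] hexagon_edge(2)[of l n] d by auto
qed

end

section \<open>The construction\<close>

lemma lie_constructionD:
  assumes "lie_construction \<Phi> c cl clm C Y D E c123"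
  shows "generated_by \<Phi> (C l) c (cl l)"
    and "l \<noteq> m \<Longrightarrow> generated_by \<Phi> (Y l m) (cl m) (clm l m)"
    and "distinct [l, m, n] \<Longrightarrow> D m \<noteq> 0 \<and> turbine (C l) (Y l m) \<inter> turbine (C n) (Y n m) = span {D m}"
    and "distinct [l, m, n] \<Longrightarrow> E l m n \<noteq> 0 \<and> E l m n = E l n m \<and>
      turbine (Y l n) (D m) \<inter> turbine (Y l m) (D n) = span {E l m n} \<and>
      clm m n \<in> contact_element \<Phi> (E l m n)"
    and "oriented_circle c123"
    and "(\<forall>l m n. distinct [l, m, n] \<longrightarrow> V \<in> contact_element \<Phi> (E l m n)) \<longleftrightarrow> same_circle c123 V"
proof -
  note L = assms[unfolded lie_construction_def]
  note L2 = L[THEN conjunct2] note L3 = L2[THEN conjunct2] note L4 = L3[THEN conjunct2]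
  note L5 = L4[THEN conjunct2]
  show "generated_by \<Phi> (C l) c (cl l)" by (rule L[THEN conjunct1, rule_format])
  show "l \<noteq> m \<Longrightarrow> generated_by \<Phi> (Y l m) (cl m) (clm l m)"
    by (rule L2[THEN conjunct1, rule_format])
  show "distinct [l, m, n] \<Longrightarrow> D m \<noteq> 0 \<and> turbine (C l) (Y l m) \<inter> turbine (C n) (Y n m) = span {D m}"
    by (rule L3[THEN conjunct1, rule_format])
  show "distinct [l, m, n] \<Longrightarrow> E l m n \<noteq> 0 \<and> E l m n = E l n m \<and>
      turbine (Y l n) (D m) \<inter> turbine (Y l m) (D n) = span {E l m n} \<and>
      clm m n \<in> contact_element \<Phi> (E l m n)"
    by (rule L4[THEN conjunct1, rule_format])
  show "oriented_circle c123" by (rule L5[THEN conjunct1])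
  show "(\<forall>l m n. distinct [l, m, n] \<longrightarrow> V \<in> contact_element \<Phi> (E l m n)) \<longleftrightarrow> same_circle c123 V"
    by (rule L5[THEN conjunct2, THEN spec])
qed

context cube_contacts
begin

lemma not_same_c_cl: "\<not> same_circle c (cl l)"
proof
  assume same: "same_circle c (cl l)"
  obtain m n where d: "distinct [l, m, n]" using other_indices by blast
  have "touch (cl l) (cl m)" using same_circle_touch[OF same] touch_c by simp
  then show False using generic d unfolding generic_hexagon_def by blast
qed

lemma not_same_cl_clm:
  assumes "l \<noteq> m"
  shows "\<not> same_circle (cl m) (clm l m)"
proof
  assume same: "same_circle (cl m) (clm l m)"
  obtain n where d: "distinct [l, m, n]" using third_index assms .
  have "touch (clm l m) (cl l)" using touch_commute hexagon_edge(3) assms by blast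
  then have "touch (cl m) (cl l)" using same_circle_touch[OF same] by simp
  then have "touch (cl l) (cl m)" using touch_commute by blast
  then show False using generic d unfolding generic_hexagon_def by blast
qed

lemma generated_C: "generated_by \<Phi> (C l) c (cl l)"
  using generated_byI[OF oriented_c oriented_cl not_same_c_cl] C by blast

lemma generated_Y: "l \<noteq> m \<Longrightarrow> generated_by \<Phi> (Y l m) (cl m) (clm l m)"
  using generated_byI[OF oriented_cl hexagon_edge(1) not_same_cl_clm] Y by blast

lemma exists_lie_construction:
  "\<exists>D E c123. cube_points \<Phi> c cl clm C Y D E \<and> lie_construction \<Phi> c cl clm C Y D E c123"
proof -
  obtain D where D: "\<And>m. D m \<noteq> 0" "\<And>l m n. distinct [l, m, n] \<Longrightarrow>
      turbine (C l) (Y l m) \<inter> turbine (C n) (Y n m) = span {D m}"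
    using exists_D by metis
  interpret T: cube_turbines \<Phi> c cl clm C Y D
    by unfold_locales (use D in blast)+
  obtain e where e: "\<And>l. e l \<noteq> 0" "\<And>l m n. distinct [l, m, n] \<Longrightarrow> e l \<in> ln (clm m n)"
    "\<And>l m n. distinct [l, m, n] \<Longrightarrow> turbine (Y l n) (D m) \<inter> turbine (Y l m) (D n) = span {e l}"
    using T.exists_E by metis
  \<comment> \<open>Letting the point depend on its first index only provides the required symmetry
    in the other two.\<close>
  define E where "E l m n = e l" for l m n :: 3
  interpret P: cube_points \<Phi> c cl clm C Y D E
    by unfold_locales (use e in \<open>auto simp: E_def\<close>)
  have np: "nonparallel (e l) (e m)" "sp (e l) (e m) = 0" if lm: "l \<noteq> m" for l m
  proof -
    obtain n where "distinct [l, m, n]" using third_index lm .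
    then show "nonparallel (e l) (e m)" "sp (e l) (e m) = 0"
      using P.nonparallel_E[of l m n] P.perp_EE[of l m n] by (simp_all add: E_def)
  qed
  have np12: "nonparallel (e 1) (e 2)" "sp (e 1) (e 2) = 0" by (simp_all add: np)
  obtain V where V: "oriented_circle V" "ln V = span {e 1, e 2}"
    using circle_of_line[OF np12] by blast
  have "e 3 \<in> ln V"
    using isotropic_span[OF np12, of "e 3"] np(2)[of 1 3] np(2)[of 2 3] V by simp
  then have eV: "e l \<in> ln V" for l
    using V(2) pair_in_span exhaust_3[of l] by auto
  have all: "(\<forall>l m n. distinct [l, m, n] \<longrightarrow> W \<in> contact_element \<Phi> (E l m n)) \<longleftrightarrow>
      oriented_circle W \<and> (\<forall>l. e l \<in> ln W)" for W
    using other_indices unfolding contact_element_def E_def by blast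
  have V_iff: "(\<forall>l m n. distinct [l, m, n] \<longrightarrow> W \<in> contact_element \<Phi> (E l m n)) \<longleftrightarrow> same_circle V W" for W
    unfolding all
  proof
    assume "oriented_circle W \<and> (\<forall>l. e l \<in> ln W)"
    then show "same_circle V W"
      using same_circle_if_line_subset[OF V(1) _ np12(1)] eV by blast
  next
    assume s: "same_circle V W"
    then show "oriented_circle W \<and> (\<forall>l. e l \<in> ln W)"
      using same_circle_oriented[OF s] same_circle_line[OF s V(1)] eV V(1) by simp
  qed
  have Ec: "clm m n \<in> contact_element \<Phi> (E l m n)" if "distinct [l, m, n]" for l m n
    using P.E_clm[OF that] hexagon_edge(1)[of m n] that by (simp add: contact_element_def)
  have EI: "turbine (Y l n) (D m) \<inter> turbine (Y l m) (D n) = span {E l m n}"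
    "E l m n \<noteq> 0" "E l m n = E l n m"
    if "distinct [l, m, n]" for l m n
    using e(3)[OF that] e(1) by (simp_all add: E_def)
  have "lie_construction \<Phi> c cl clm C Y D E V"
    unfolding lie_construction_def
    by (intro conjI allI impI) (rule V(1) V_iff generated_C D(1) | erule generated_Y D(2) Ec EI)+
  then show ?thesis using P.cube_points_axioms by blast
qed

end

section \<open>The opposite circle described by touching alone\<close>

definition linked :: "lvec \<Rightarrow> lvec \<Rightarrow> lvec \<Rightarrow> lvec \<Rightarrow> bool" where
  "linked A B A' B' \<longleftrightarrow>
     (\<exists>X. oriented_circle X \<and> touch X A \<and> touch X B \<and> touch X A' \<and> touch X B')"

text \<open>\<open>U\<close> and \<open>U'\<close> stand for the contact element \<open>D l\<close>.
  The first three links are the orthogonality relations that determine it, and the last one forces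
  the contact of \<open>V\<close> with \<open>c\<^sub>m\<^sub>n\<close> to be
  \<open>E l m n\<close>.\<close>

definition lie_opposite ::
    "lvec \<Rightarrow> (3 \<Rightarrow> lvec) \<Rightarrow> (3 \<Rightarrow> 3 \<Rightarrow> lvec) \<Rightarrow> lvec \<Rightarrow> bool" where
  "lie_opposite c cl clm V \<longleftrightarrow> oriented_circle V \<and>
     (\<forall>l m. l \<noteq> m \<longrightarrow> touch V (clm l m)) \<and>
     (\<forall>l m n. distinct [l, m, n] \<longrightarrow> (\<exists>U U'. oriented_circle U \<and> oriented_circle U' \<and>
        touch U U' \<and> \<not> same_circle U U' \<and> linked U U' c (cl l) \<and>
        linked U U' (cl m) (clm l m) \<and> linked U U' (cl n) (clm l n) \<and> linked U U' V (clm m n)))"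

context lie_model
begin

lemma linkedI:
  assumes "oriented_circle A" "oriented_circle B" "oriented_circle A'" "oriented_circle B'"
    and "a \<noteq> 0" "a \<in> ln A" "a \<in> ln B" "b \<noteq> 0" "b \<in> ln A'" "b \<in> ln B'" "sp a b = 0"
  shows "linked A B A' B'"
proof -
  obtain X where "oriented_circle X" "a \<in> ln X" "b \<in> ln X"
    using circle_through_perp assms by blast
  then show ?thesis unfolding linked_def using touch_if_common_point assms by blast
qed

text \<open>The lines of \<open>A\<close>, \<open>B\<close> and \<open>X\<close> meet pairwise and
  cannot form a triangle, so \<open>X\<close> passes through the common point of the other
  two.\<close>

lemma circle_through_contact:
  assumes "oriented_circle X" "oriented_circle A" "oriented_circle B" "touch X A" "touch X B"
    and g: "generated_by \<Phi> a A B"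
  shows "a \<in> ln X"
proof -
  obtain u where u: "u \<noteq> 0" "u \<in> ln X" "u \<in> ln A" using touching_circles_meet assms by blast
  obtain v where v: "v \<noteq> 0" "v \<in> ln X" "v \<in> ln B" using touching_circles_meet assms by blast
  have "ln A \<inter> ln B = span {a}" using g by (simp add: generated_by_def)
  then show ?thesis
    using lagrangian_concurrent[of "ln A" "ln B" "ln X" a u v] lagrangian_circle assms u v
      generated_byD[OF g] by blast
qed

lemma linked_perp:
  assumes "oriented_circle A" "oriented_circle B" "oriented_circle A'" "oriented_circle B'"
    and "generated_by \<Phi> a A B" "generated_by \<Phi> b A' B'" "linked A B A' B'"
  shows "sp a b = 0"
proof -
  obtain X where X: "oriented_circle X" "touch X A" "touch X B" "touch X A'" "touch X B'"
    using assms(7) unfolding linked_def by blast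
  then have "a \<in> ln X" "b \<in> ln X"
    using circle_through_contact[OF X(1) assms(1,2) X(2,3) assms(5)]
      circle_through_contact[OF X(1) assms(3,4) X(4,5) assms(6)] by simp_all
  then show ?thesis using lagrangian_isotropic lagrangian_circle X(1) by blast
qed

lemma cube_points_if_construction:
  assumes "generic_hexagon cl clm" "oriented_circle c" "\<And>l. touch c (cl l)"
    and L: "lie_construction \<Phi> c cl clm C Y D E V"
  shows "cube_points \<Phi> c cl clm C Y D E"
proof -
  note L = lie_constructionD[OF L]
  have Dn: "D m \<noteq> 0" for m
  proof -
    obtain l n where "distinct [m, l, n]" using other_indices by blast
    then show ?thesis using L(3)[of l m n] by auto
  qed
  have Ec: "E l m n \<in> ln (clm m n)" if "distinct [l, m, n]" for l m n
    using L(4)[OF that] unfolding contact_element_def by blast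
  show ?thesis
    by unfold_locales (rule assms(1-3) generated_byD[OF L(1)] Dn
      | erule generated_byD[OF L(2)] L(3)[THEN conjunct2] L(4)[THEN conjunct1] Ec
        L(4)[THEN conjunct2, THEN conjunct2, THEN conjunct1])+
qed

end

context cube_points
begin

lemma lie_opposite_construction:
  assumes L: "lie_construction \<Phi> c cl clm C Y D E c123"
  shows "lie_opposite c cl clm c123"
proof -
  note V = lie_constructionD(5,6)[OF L]
  have "same_circle c123 c123" unfolding same_circle_def by (intro exI[of _ 1]) simp
  then have EV: "distinct [l, m, n] \<Longrightarrow> E l m n \<in> ln c123" for l m n
    using V(2)[of c123] unfolding contact_element_def by blast
  have "touch c123 (clm m n)" if mn: "m \<noteq> n" for m n
  proof -
    obtain l where "distinct [m, n, l]" using third_index mn .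
    then have d: "distinct [l, m, n]" by auto
    show ?thesis
      using touch_if_common_point[OF V(1) hexagon_edge(1)[OF mn] E_nonzero[OF d] EV[OF d] E_clm[OF d]] .
  qed
  moreover have "\<exists>U U'. oriented_circle U \<and> oriented_circle U' \<and>
        touch U U' \<and> \<not> same_circle U U' \<and> linked U U' c (cl l) \<and>
        linked U U' (cl m) (clm l m) \<and> linked U U' (cl n) (clm l n) \<and> linked U U' c123 (clm m n)"
    if d: "distinct [l, m, n]" for l m n
  proof -
    note ne = distinct3D[OF d]
    \<comment> \<open>Both circles pass through \<open>D l\<close>. They differ because
      \<open>C l\<close> and \<open>Y l m\<close>, which are not orthogonal, lie on no common line
      of the complex.\<close>
    obtain U where U: "oriented_circle U" "D l \<in> ln U" "C l \<in> ln U"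
      using circle_through_perp[OF D_nonzero C(1) perp_DC] .
    obtain U' where U': "oriented_circle U'" "D l \<in> ln U'" "Y l m \<in> ln U'"
      using circle_through_perp[OF D_nonzero Y(1) perp_DY] ne by metis
    have "\<not> same_circle U U'"
    proof
      assume "same_circle U U'"
      then have "Y l m \<in> ln U" using same_circle_line U(1) U'(3) by simp
      then have "sp (C l) (Y l m) = 0" using lagrangian_isotropic lagrangian_circle U by blast
      then show False using nonperp_CY ne by simp
    qed
    moreover have "touch U U'" using touch_if_common_point D_nonzero U U' by blast
    moreover note I = linkedI[OF U(1) U'(1) _ _ D_nonzero U(2) U'(2)]
    have "linked U U' c (cl l)" using I oriented_c oriented_cl C perp_DC by blast
    moreover have "linked U U' (cl m) (clm l m)" "linked U U' (cl n) (clm l n)"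
      using I oriented_cl hexagon_edge(1) Y perp_DY ne by meson+
    moreover have "linked U U' c123 (clm m n)"
    proof (rule I)
      show "sp (D l) (E l m n) = 0" using perp_ED[OF d] sp_commute_zero by blast
    qed (use V(1) hexagon_edge(1) ne E_nonzero[OF d] EV[OF d] E_clm[OF d] in auto)
    ultimately show ?thesis using U(1) U'(1) by blast
  qed
  ultimately show ?thesis unfolding lie_opposite_def using V(1) by blast
qed

text \<open>The contact of \<open>U\<close> and \<open>U'\<close> must be \<open>D l\<close> by
  \<open>D_unique\<close>, so the contact of \<open>V\<close> with \<open>c\<^sub>m\<^sub>n\<close>
  must be \<open>E l m n\<close> by \<open>E_unique\<close>, and \<open>V\<close> belongs to all
  three contact elements.\<close>

lemma lie_opposite_unique:
  assumes L: "lie_construction \<Phi> c cl clm C Y D E c123" and V: "lie_opposite c cl clm V"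
  shows "same_circle c123 V"
proof -
  have oV: "oriented_circle V" and tV: "\<And>l m. l \<noteq> m \<Longrightarrow> touch V (clm l m)"
    using V unfolding lie_opposite_def by blast+
  have "E l m n \<in> ln V" if d: "distinct [l, m, n]" for l m n
  proof -
    note ne = distinct3D[OF d]
    obtain U U' where U: "oriented_circle U" "oriented_circle U'" "touch U U'" "\<not> same_circle U U'"
        "linked U U' c (cl l)" "linked U U' (cl m) (clm l m)" "linked U U' (cl n) (clm l n)"
        "linked U U' V (clm m n)"
      using V d unfolding lie_opposite_def by blast
    obtain u where u: "u \<noteq> 0" "u \<in> ln U" "u \<in> ln U'" using touching_circles_meet U by blast
    have gu: "generated_by \<Phi> u U U'" using generated_byI U u by blast
    have o: "oriented_circle (clm l m)" "oriented_circle (clm l n)" "oriented_circle (clm m n)"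
      using hexagon_edge(1) ne by simp_all
    have "sp u (C l) = 0" using linked_perp[OF U(1,2) oriented_c oriented_cl gu generated_C U(5)] .
    moreover have "sp u (Y l m) = 0"
      using linked_perp[OF U(1,2) oriented_cl o(1) gu generated_Y U(6)] ne by blast
    moreover have "sp u (Y l n) = 0"
      using linked_perp[OF U(1,2) oriented_cl o(2) gu generated_Y U(7)] ne by blast
    ultimately have "u \<in> span {D l}" using D_unique[OF d] by blast
    then have "D l \<in> span {u}" using span_singleton_commute u(1) by blast
    then obtain k where k: "D l = k *\<^sub>R u" by (auto simp: span_singleton)
    obtain v where v: "v \<noteq> 0" "v \<in> ln V" "v \<in> ln (clm m n)"
      using touching_circles_meet[OF oV o(3)] tV ne by blast
    have "\<not> same_circle V (clm m n)"
    proof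
      assume s: "same_circle V (clm m n)"
      have "touch V (clm l m)" using tV ne by simp
      then have "touch (clm l m) (clm m n)" using same_circle_touch[OF s] touch_commute by blast
      then show False using generic d unfolding generic_hexagon_def by blast
    qed
    then have gv: "generated_by \<Phi> v V (clm m n)" using generated_byI oV o(3) v by blast
    have "sp u v = 0" using linked_perp[OF U(1,2) oV o(3) gu gv U(8)] .
    then have "sp v (D l) = 0" using k sp_commute_zero[of u v] by simp
    then have "v \<in> span {E l m n}" using E_unique[OF d v(3)] by blast
    then have "E l m n \<in> span {v}" using span_singleton_commute v(1) by blast
    then show ?thesis using in_subspace_if_parallel[OF subspace_circle[OF oV] v(2)] by blast
  qed
  then have "\<forall>l m n. distinct [l, m, n] \<longrightarrow> V \<in> contact_element \<Phi> (E l m n)"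
    using oV unfolding contact_element_def by blast
  then show ?thesis using lie_constructionD(6)[OF L] by blast
qed

section \<open>The auxiliary circles in the plane\<close>

lemma turbine_points_memI:
  "\<gamma> \<noteq> 0 \<Longrightarrow> located \<Phi> \<gamma> p \<Longrightarrow> \<gamma> \<in> span {\<alpha>, \<beta>} \<Longrightarrow> p \<in> turbine_points \<alpha> \<beta>"
  by (auto simp: turbine_points_def turbine_def)

lemma turbine_points_CY: "l \<noteq> m \<Longrightarrow> turbine_points (C l) (Y l m) = turbine_points (C m) (Y m l)"
  using turbine_points_polar[of "C l" "Y l m" "C m" "Y m l"] nonperp_CY[of l m] nonperp_CY[of m l]
    perp_CC[of l m] perp_CY[of m l] perp_CY[of l m] sp_commute_zero[of "C m" "Y l m"]
    perp_YY_clm[of l m]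
  by simp

lemma turbine_points_YD:
  assumes d: "distinct [l, m, n]"
  shows "turbine_points (Y l n) (D m) = turbine_points (Y m n) (D l)"
proof (rule turbine_points_polar)
  show "sp (Y l n) (D m) \<noteq> 0" using nonperp_DY[of m l n] sp_commute_zero d by auto
  show "sp (Y m n) (D l) \<noteq> 0" using nonperp_DY[of l m n] sp_commute_zero d by auto
qed (use perp_YY_cl perp_YD perp_DY perp_DD distinct3D[OF d] in simp_all)

text \<open>The line of a common point meets the two turbines in vectors \<open>a\<close> and
  \<open>b\<close>, both orthogonal to \<open>C m\<close>. If they are independent, they span that
  line, which therefore contains \<open>C m\<close>; if they are proportional, they lie in both
  turbines and give \<open>D m\<close>.\<close>

lemma turbine_points_inter:
  assumes d: "distinct [l, m, n]" and p: "located \<Phi> (C m) p" and q: "located \<Phi> (D m) q"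
  shows "turbine_points (C l) (Y l m) \<inter> turbine_points (C n) (Y n m) = {p, q}"
proof
  note ne = distinct3D[OF d]
  \<comment> \<open>\<open>C m\<close> belongs to the polar turbines, which the same two circles
    represent.\<close>
  have "C m \<in> span {C m, Y m l}" "C m \<in> span {C m, Y m n}" by (simp_all add: pair_in_span)
  then have "p \<in> turbine_points (C m) (Y m l)" "p \<in> turbine_points (C m) (Y m n)"
    using turbine_points_memI C(1) p by blast+
  moreover have "q \<in> turbine_points (C l) (Y l m)" "q \<in> turbine_points (C n) (Y n m)"
    using turbine_points_memI D_nonzero q D_in_turbine ne by blast+
  ultimately show "{p, q} \<subseteq> turbine_points (C l) (Y l m) \<inter> turbine_points (C n) (Y n m)"
    using turbine_points_CY[of m l] turbine_points_CY[of m n] ne by simp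
  show "turbine_points (C l) (Y l m) \<inter> turbine_points (C n) (Y n m) \<subseteq> {p, q}"
  proof
    fix r assume "r \<in> turbine_points (C l) (Y l m) \<inter> turbine_points (C n) (Y n m)"
    then obtain a b where ab: "a \<in> span {C l, Y l m}" "a \<noteq> 0" "a \<in> ln (point_circle r)"
        "b \<in> span {C n, Y n m}" "b \<noteq> 0" "b \<in> ln (point_circle r)"
      by (auto simp: turbine_points_def turbine_def located_iff)
    have "sp (C m) (C l) = 0" "sp (C m) (Y l m) = 0" "sp (C m) (C n) = 0" "sp (C m) (Y n m) = 0"
      using perp_CC perp_CY ne by simp_all
    then have perp: "sp a (C m) = 0" "sp b (C m) = 0" using ab sp_span_pair(2) by blast+
    show "r \<in> {p, q}"
    proof (cases "nonparallel a b")
      case True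
      then have "C m \<in> ln (point_circle r)"
        using lagrangian_in[OF lagrangian_circle[OF oriented_point_circle] True] ab perp by blast
      then show ?thesis using location_unique[OF C(1) p] located_iff by blast
    next
      case False
      then have "b \<in> span {a}" using not_nonparallel ab(2) by blast
      then have "b \<in> span {C l, Y l m}" using in_subspace_if_parallel[OF subspace_span ab(1)] by blast
      then have "b \<in> span {D m}" using D_inter[OF d] ab(4) by (auto simp: turbine_def)
      then have "D m \<in> span {b}" using span_singleton_commute ab(5) by blast
      then have "D m \<in> ln (point_circle r)"
        using in_subspace_if_parallel[OF subspace_circle[OF oriented_point_circle] ab(6)] by blast
      then show ?thesis using location_unique[OF D_nonzero q] located_iff by blast
    qed
  qed
qed

lemma exists_planar_construction:
  assumes V: "oriented_circle c123" "\<And>l m n. distinct [l, m, n] \<Longrightarrow> E l m n \<in> ln c123"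
  shows "\<exists>p p' q s A A'. planar_construction \<Phi> clm C Y D E p p' q s A A' c123"
proof -
  define loc where "loc \<alpha> = (SOME p. located \<Phi> \<alpha> p)" for \<alpha>
  have loc: "located \<Phi> \<alpha> (loc \<alpha>)" if "\<alpha> \<noteq> 0" for \<alpha>
    unfolding loc_def using exists_location[OF that] by (rule someI_ex)
  have mem: "loc \<gamma> \<in> turbine_points \<alpha> \<beta>" if "\<gamma> \<noteq> 0" "\<gamma> \<in> span {\<alpha>, \<beta>}" for \<gamma> \<alpha> \<beta>
    using turbine_points_memI[OF that(1) loc[OF that(1)] that(2)] .
  have on: "loc \<gamma> \<in> points_on W" if "\<gamma> \<noteq> 0" "oriented_circle W" "\<gamma> \<in> ln W" for \<gamma> W
    using touch_if_common_point[OF oriented_point_circle that(2,1)] loc[OF that(1)] that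
    by (simp add: points_on_def located_iff)
  have CY: "{loc (C l), loc (C m), loc (Y l m), loc (Y m l)} \<subseteq> turbine_points (C l) (Y l m)"
    if "l \<noteq> m" for l m
    using mem[OF C(1) pair_in_span(1), of l "Y l m"] mem[OF C(1) pair_in_span(1), of m "Y m l"]
      mem[OF Y(1) pair_in_span(2), of l m "C l"] mem[OF Y(1) pair_in_span(2), of m l "C m"]
      turbine_points_CY[of l m] that by simp
  have YD: "{loc (Y l n), loc (Y m n), loc (D l), loc (D m)} \<subseteq> turbine_points (Y l n) (D m)"
    if d: "distinct [l, m, n]" for l m n
    using mem[OF Y(1) pair_in_span(1), of l n "D m"] mem[OF Y(1) pair_in_span(1), of m n "D l"]
      mem[OF D_nonzero pair_in_span(2), of m "Y l n"] mem[OF D_nonzero pair_in_span(2), of l "Y m n"]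
      turbine_points_YD[OF d] distinct3D[OF d] by simp
  have E: "loc (E l m n) \<in> turbine_points (Y l n) (D m) \<inter> turbine_points (Y l m) (D n) \<inter>
      points_on (clm m n)" "loc (E l m n) \<in> points_on c123" if d: "distinct [l, m, n]" for l m n
  proof -
    have "E l m n \<in> span {Y l n, D m} \<inter> span {Y l m, D n}"
      using E_inter[OF d] span_base[of "E l m n" "{E l m n}"] by (simp add: turbine_def)
    then show "loc (E l m n) \<in> turbine_points (Y l n) (D m) \<inter> turbine_points (Y l m) (D n) \<inter>
        points_on (clm m n)" "loc (E l m n) \<in> points_on c123"
      using mem[OF E_nonzero[OF d]] on[OF E_nonzero[OF d]] E_clm[OF d] V(2)[OF d] V(1)
        hexagon_edge(1)[of m n] distinct3D[OF d] by blast+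
  qed
  have CYr: "represents_turbine \<Phi> (turbine_points (C l) (Y l m)) (C l) (Y l m)" if "l \<noteq> m" for l m
    using represents_turbine_points nonperp_CY[OF that] by blast
  have YDr: "represents_turbine \<Phi> (turbine_points (Y l n) (D m)) (Y l n) (D m)"
    if d: "distinct [l, m, n]" for l m n
    using represents_turbine_points[of "Y l n" "D m"] nonperp_DY[of m l n] sp_commute_zero d by auto
  have "planar_construction \<Phi> clm C Y D E (\<lambda>l. loc (C l)) (\<lambda>l m. loc (Y l m)) (\<lambda>l. loc (D l))
     (\<lambda>l m n. loc (E l m n)) (\<lambda>l m. turbine_points (C l) (Y l m))
     (\<lambda>l m n. turbine_points (Y l n) (D m)) c123"
    unfolding planar_construction_def
  proof (intro conjI allI impI)
    show "{loc (E 1 2 3), loc (E 2 1 3), loc (E 3 1 2)} \<subseteq> points_on c123"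
      using E(2)[of 1 2 3] E(2)[of 2 1 3] E(2)[of 3 1 2] by simp
  qed (rule loc[OF C(1)] loc[OF D_nonzero]
      | erule loc[OF Y(1)] loc[OF E_nonzero] turbine_points_CY CYr CY
        turbine_points_inter[OF _ loc[OF C(1)] loc[OF D_nonzero]] turbine_points_YD YDr YD E(1))+
  then show ?thesis by blast
qed

end

text \<open>Uniqueness determines a circle only up to a homogeneous factor, so the construction must
  not depend on it.\<close>

lemma constructed_same_circle:
  assumes "constructed \<Phi> c cl clm V" "same_circle V V'"
  shows "constructed \<Phi> c cl clm V'"
proof -
  obtain C Y D E p p' q s A A' where L: "lie_construction \<Phi> c cl clm C Y D E V"
    and P: "planar_construction \<Phi> clm C Y D E p p' q s A A' V"
    using assms(1) unfolding constructed_def by blast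
  have same: "same_circle V' W \<longleftrightarrow> same_circle V W" for W
    using same_circle_trans same_circle_sym assms(2) by blast
  have "lie_construction \<Phi> c cl clm C Y D E V'"
    using L unfolding lie_construction_def same_circle_oriented[OF assms(2)] same .
  moreover have points: "points_on V' = points_on V"
    unfolding points_on_def using same_circle_touch[OF assms(2)] touch_commute by blast
  have "planar_construction \<Phi> clm C Y D E p p' q s A A' V'"
    using P unfolding planar_construction_def points .
  ultimately show ?thesis unfolding constructed_def by blast
qed

context lie_model
begin

lemma exists_cube_contacts:
  assumes g: "generic_hexagon cl clm" and c: "oriented_circle c" "\<And>l. touch c (cl l)"
  shows "\<exists>C Y. cube_contacts \<Phi> c cl clm C Y"
proof -
  have o: "oriented_circle (cl l)" "l \<noteq> m \<Longrightarrow> oriented_circle (clm l m)"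
    "l \<noteq> m \<Longrightarrow> touch (cl m) (clm l m)" for l m
    using g unfolding generic_hexagon_def touching_hexagon_def by metis+
  have "\<exists>u. u \<noteq> 0 \<and> u \<in> ln c \<and> u \<in> ln (cl l)" for l
    using touch_iff_meet[OF c(1) o(1)] c(2) by blast
  then obtain C where C: "\<And>l. C l \<noteq> 0 \<and> C l \<in> ln c \<and> C l \<in> ln (cl l)" by metis
  have "\<exists>y. l \<noteq> m \<longrightarrow> y \<noteq> 0 \<and> y \<in> ln (cl m) \<and> y \<in> ln (clm l m)" for l m
    using touch_iff_meet[OF o(1) o(2)] o(3) by blast
  then obtain Y where "\<And>l m. l \<noteq> m \<longrightarrow> Y l m \<noteq> 0 \<and> Y l m \<in> ln (cl m) \<and> Y l m \<in> ln (clm l m)"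
    by metis
  then have "cube_contacts \<Phi> c cl clm C Y" using g c C by unfold_locales blast+
  then show ?thesis by blast
qed

end

context cube_contacts
begin

lemma exists_constructed:
  "\<exists>D E c123. cube_points \<Phi> c cl clm C Y D E \<and> lie_construction \<Phi> c cl clm C Y D E c123 \<and>
     constructed \<Phi> c cl clm c123"
proof -
  obtain D E c123 where P: "cube_points \<Phi> c cl clm C Y D E"
    and L: "lie_construction \<Phi> c cl clm C Y D E c123"
    using exists_lie_construction by blast
  interpret cube_points \<Phi> c cl clm C Y D E by (rule P)
  note V = lie_constructionD(5,6)[OF L]
  have "same_circle c123 c123" unfolding same_circle_def by (intro exI[of _ 1]) simp
  then have "distinct [l, m, n] \<Longrightarrow> E l m n \<in> ln c123" for l m n
    using V(2)[of c123] unfolding contact_element_def by blast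
  then show ?thesis using exists_planar_construction[OF V(1)] L P unfolding constructed_def by blast
qed

end

context lie_model
begin

text \<open>In the converse direction some construction is carried out from arbitrary contact
  points; its result is \<open>V\<close> up to a factor, by uniqueness.\<close>

lemma constructed_iff_lie_opposite:
  assumes g: "generic_hexagon cl clm" and c: "oriented_circle c" "\<And>l. touch c (cl l)"
  shows "constructed \<Phi> c cl clm V \<longleftrightarrow> lie_opposite c cl clm V"
proof
  assume "constructed \<Phi> c cl clm V"
  then obtain C Y D E where L: "lie_construction \<Phi> c cl clm C Y D E V"
    unfolding constructed_def by blast
  interpret cube_points \<Phi> c cl clm C Y D E using cube_points_if_construction assms L by blast
  show "lie_opposite c cl clm V" using lie_opposite_construction L .
next
  assume V: "lie_opposite c cl clm V"
  obtain C Y where "cube_contacts \<Phi> c cl clm C Y" using exists_cube_contacts assms by blast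
  then obtain D E c123 where P: "cube_points \<Phi> c cl clm C Y D E"
    and L: "lie_construction \<Phi> c cl clm C Y D E c123" and c: "constructed \<Phi> c cl clm c123"
    using cube_contacts.exists_constructed by blast
  interpret cube_points \<Phi> c cl clm C Y D E by (rule P)
  show "constructed \<Phi> c cl clm V"
    using constructed_same_circle[OF c] lie_opposite_unique[OF L V] by blast
qed

lemma lie_opposite_same_circle:
  assumes "generic_hexagon cl clm" "oriented_circle c" "\<And>l. touch c (cl l)"
    and V: "lie_opposite c cl clm V"
  shows "lie_opposite c cl clm V' \<longleftrightarrow> same_circle V V'"
proof
  assume V': "lie_opposite c cl clm V'"
  obtain C Y where "cube_contacts \<Phi> c cl clm C Y" using exists_cube_contacts assms by blast
  then obtain D E c123 where P: "cube_points \<Phi> c cl clm C Y D E"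
    and L: "lie_construction \<Phi> c cl clm C Y D E c123"
    using cube_contacts.exists_constructed by blast
  interpret cube_points \<Phi> c cl clm C Y D E by (rule P)
  show "same_circle V V'"
    using lie_opposite_unique[OF L V] lie_opposite_unique[OF L V'] same_circle_sym same_circle_trans
    by blast
next
  assume "same_circle V V'"
  then show "lie_opposite c cl clm V'"
    using constructed_iff_lie_opposite[OF assms(1-3)] constructed_same_circle V by blast
qed

end

section \<open>Lie transformations\<close>

lemma lie_transformation_form: "lie_transformation T \<Longrightarrow> lie_form (T V) (T W) = lie_form V W"
  unfolding lie_transformation_def by blast

lemma lie_transformation_bij:
  assumes "lie_transformation T"
  shows "bij T" "linear T"
proof -
  show lin: "linear T" using assms by (simp add: lie_transformation_def)
  have "V = 0" if "T V = 0" for V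
  proof -
    have "lie_form V W = 0" for W
      using lie_transformation_form[OF assms, of V W] that lie_form_commute[of "T V" "T W"] by simp
    then show ?thesis by (rule lie_form_nondegenerate)
  qed
  then have inj: "inj T" using linear_injective_0[OF lin] by blast
  then have "surj T" by (intro linear_injective_imp_surjective lin) simp_all
  then show "bij T" using inj by (simp add: bij_def)
qed

context
  fixes T :: "lvec \<Rightarrow> lvec"
  assumes T: "lie_transformation T"
begin

lemma lie_transformation_touch: "touch (T V) (T W) \<longleftrightarrow> touch V W"
  by (simp only: lie_transformation_form[OF T] touch_def)

lemma lie_transformation_oriented: "oriented_circle (T V) \<longleftrightarrow> oriented_circle V"
proof -
  have "T V = 0 \<longleftrightarrow> V = 0"
    using lie_transformation_bij[OF T] linear_injective_0[of T] linear_0[of T]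
    unfolding bij_def by metis
  then show ?thesis by (simp only: oriented_circle_def lie_transformation_form[OF T])
qed

lemma lie_transformation_same: "same_circle (T V) (T W) \<longleftrightarrow> same_circle V W"
  using lie_transformation_bij[OF T] linear_cmul[of T]
  by (metis same_circle_def bij_is_inj inj_eq)

lemma lie_transformation_linked: "linked (T A) (T B) (T A') (T B') \<longleftrightarrow> linked A B A' B'"
proof -
  \<comment> \<open>By surjectivity the linking circle may be sought among the images of
    \<open>T\<close>.\<close>
  have ex: "(\<exists>X. P X) \<longleftrightarrow> (\<exists>X. P (T X))" for P
    using lie_transformation_bij(1)[OF T] by (metis bij_pointE)
  show ?thesis
    unfolding linked_def by (subst ex)
      (simp only: lie_transformation_touch lie_transformation_oriented)
qed

lemma lie_transformation_generic:
  "generic_hexagon (\<lambda>l. T (cl l)) (\<lambda>l m. T (clm l m)) \<longleftrightarrow> generic_hexagon cl clm"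
proof -
  have "T V = T W \<longleftrightarrow> V = W" for V W
    using lie_transformation_bij(1)[OF T] by (simp add: bij_is_inj inj_eq)
  then show ?thesis
    by (simp only: generic_hexagon_def touching_hexagon_def lie_transformation_touch
        lie_transformation_oriented)
qed

lemma lie_transformation_opposite:
  assumes "lie_opposite c cl clm V"
  shows "lie_opposite (T c) (\<lambda>l. T (cl l)) (\<lambda>l m. T (clm l m)) (T V)"
  unfolding lie_opposite_def
proof (intro conjI allI impI)
  fix l m n :: 3 assume "distinct [l, m, n]"
  then obtain U U' where U: "oriented_circle U" "oriented_circle U'" "touch U U'" "\<not> same_circle U U'"
    "linked U U' c (cl l)" "linked U U' (cl m) (clm l m)" "linked U U' (cl n) (clm l n)"
    "linked U U' V (clm m n)"
    using assms unfolding lie_opposite_def by blast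
  show "\<exists>U U'. oriented_circle U \<and> oriented_circle U' \<and> touch U U' \<and> \<not> same_circle U U' \<and>
      linked U U' (T c) (T (cl l)) \<and> linked U U' (T (cl m)) (T (clm l m)) \<and>
      linked U U' (T (cl n)) (T (clm l n)) \<and> linked U U' (T V) (T (clm m n))"
    by (rule exI[of _ "T U"], rule exI[of _ "T U'"])
      (simp add: U lie_transformation_touch lie_transformation_oriented lie_transformation_linked
        lie_transformation_same)
qed (use assms in \<open>auto simp: lie_opposite_def lie_transformation_touch lie_transformation_oriented\<close>)

end

lemma (in lie_model) lie_well_defined_construction:
  assumes g: "generic_hexagon cl clm" and c: "oriented_circle c" "\<And>l. touch c (cl l)"
    and V: "constructed \<Phi> c cl clm V"
  shows "lie_well_defined \<Phi> c cl clm V"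
  unfolding lie_well_defined_def
proof (intro allI impI)
  fix T W assume T: "lie_transformation T"
  have g': "generic_hexagon (\<lambda>l. T (cl l)) (\<lambda>l m. T (clm l m))"
    using lie_transformation_generic[OF T] g by blast
  have c': "oriented_circle (T c)" "\<And>l. touch (T c) (T (cl l))"
    using lie_transformation_oriented[OF T] lie_transformation_touch[OF T] c by blast+
  have "lie_opposite (T c) (\<lambda>l. T (cl l)) (\<lambda>l m. T (clm l m)) (T V)"
    using lie_transformation_opposite[OF T] constructed_iff_lie_opposite[OF g c] V by blast
  then show "constructed \<Phi> (T c) (\<lambda>l. T (cl l)) (\<lambda>l m. T (clm l m)) W \<longleftrightarrow> same_circle (T V) W"
    using constructed_iff_lie_opposite[OF g' c'] lie_opposite_same_circle[OF g' c'] by blast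
qed

section \<open>The correlation of a hexagon\<close>

lemma UNIV_6: "(UNIV :: 6 set) = {0, 1, 2, 3, 4, 5}"
proof -
  have card: "card {0, 1, 2, 3, 4, 5 :: 6} = CARD(6)" by simp
  show ?thesis using card_subset_eq[OF finite subset_UNIV card] by (rule sym)
qed

lemma all_index6: "(\<forall>i::6. P i) \<longleftrightarrow> P 0 \<and> P 1 \<and> P 2 \<and> P 3 \<and> P 4 \<and> P 5"
  using UNIV_6 by (metis UNIV_I empty_iff insert_iff)

lemma index6_wrap: "(6::6) = 0" "(7::6) = 1" "(8::6) = 2"
  by simp_all

lemma general_position_span:
  assumes "general_position x" "distinct [i, j, k, l]"
  shows "span {x i, x j, x k, x l} = UNIV"
proof -
  have "card {i, j, k, l} = 4" using assms(2) by simp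
  then have ind: "independent (x ` {i, j, k, l})"
    using assms(1) unfolding general_position_def by blast
  have "inj_on x {i, j, k, l}"
    using assms(1) unfolding general_position_def by (meson inj_on_subset subset_UNIV)
  then have card: "card (x ` {i, j, k, l}) = 4"
    using card_image \<open>card {i, j, k, l} = 4\<close> by metis
  have "dim (UNIV :: (real^4) set) \<le> card (x ` {i, j, k, l})" using card by simp
  then have "UNIV \<subseteq> span (x ` {i, j, k, l})"
    using card_ge_dim_independent[OF _ ind, of UNIV] by simp
  then show ?thesis by auto
qed

lemma linear_vanishes:
  assumes "linear f" "span {a, b, c, d} = UNIV" "f a = 0" "f b = 0" "f c = 0" "f d = 0"
  shows "f v = 0"
  using linear_eq_0_on_span[of f "{a, b, c, d}" v] assms by auto

lemma linear_sp: "linear (sp a)"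
  by (rule linearI) simp_all

lemma sp_vanishes:
  assumes "span {a, b, c, d} = UNIV" "sp v a = 0" "sp v b = 0" "sp v c = 0" "sp v d = 0"
  shows "v = 0"
  using linear_vanishes[OF linear_sp assms] sp_nondegenerate by blast

lemma inner_vanishes:
  assumes "span {a, b, c, d} = UNIV" "inner a v = 0" "inner b v = 0" "inner c v = 0" "inner d v = 0"
  shows "(v :: real^4) = 0"
proof -
  have "linear (\<lambda>u. inner u v)" by (rule linearI) (simp_all add: inner_add_left)
  then have "inner v v = 0" using linear_vanishes[of "\<lambda>u. inner u v"] assms by blast
  then show ?thesis by simp
qed

section \<open>Conjugate points and the existence of the correlation\<close>

definition conj_form :: "real^4^4 \<Rightarrow> real^4 \<Rightarrow> real^4 \<Rightarrow> real" where
  "conj_form B u v = inner u (B *v v)"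

lemma conj_form_bilinear [simp]:
  "conj_form B (u + u') v = conj_form B u v + conj_form B u' v"
  "conj_form B u (v + v') = conj_form B u v + conj_form B u v'"
  "conj_form B (u - u') v = conj_form B u v - conj_form B u' v"
  "conj_form B u (v - v') = conj_form B u v - conj_form B u v'"
  "conj_form B (s *\<^sub>R u) v = s * conj_form B u v"
  "conj_form B u (s *\<^sub>R v) = s * conj_form B u v"
  "conj_form B 0 v = 0" "conj_form B u 0 = 0"
  by (simp_all add: conj_form_def inner_add_left inner_add_right inner_diff_left inner_diff_right
      matrix_vector_right_distrib matrix_vector_mult_diff_distrib matrix_vector_mult_scaleR)

lemma conj_form_sym: "transpose B = B \<Longrightarrow> conj_form B u v = conj_form B v u"
  unfolding conj_form_def by (metis dot_lmul_matrix inner_commute transpose_matrix_vector)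

text \<open>A dimension count: 16 matrix entries against 6 conditions for symmetry, 6 for the
  vertices two steps apart and 3 for the opposite ones.\<close>

lemma exists_conj_form:
  fixes x :: "6 \<Rightarrow> real^4"
  shows "\<exists>B. B \<noteq> 0 \<and> transpose B = B \<and>
     (\<forall>i. conj_form B (x i) (x (i + 2)) = 0 \<and> conj_form B (x i) (x (i + 3)) = 0)"
proof -
  \<comment> \<open>For the entrywise inner product of matrices, \<open>outer u v\<close> represents
    \<open>conj_form B u v\<close> as a linear functional of \<open>B\<close>.\<close>
  define outer :: "real^4 \<Rightarrow> real^4 \<Rightarrow> real^4^4" where "outer u v = (\<chi> i j. u $ i * v $ j)" for u v
  have outer: "inner B (outer u v) = conj_form B u v" for B u v
    by (simp add: outer_def conj_form_def inner_vec_def matrix_vector_mult_def sum_distrib_left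
        mult.assoc mult.left_commute)
  define alt where "alt i j = outer (axis i 1) (axis j 1) - outer (axis j 1) (axis i 1)" for i j
  have alt: "inner B (alt i j) = B $ i $ j - B $ j $ i" for B i j
    by (simp add: alt_def inner_diff_right outer conj_form_def inner_axis' matrix_vector_mul_component
        inner_axis)
  define ms where "ms = [alt 0 1, alt 0 2, alt 0 3, alt 1 2, alt 1 3, alt 2 3,
    outer (x 0) (x 2), outer (x 1) (x 3), outer (x 2) (x 4), outer (x 3) (x 5), outer (x 4) (x 0),
    outer (x 5) (x 1), outer (x 0) (x 3), outer (x 1) (x 4), outer (x 2) (x 5)]"
  have "card (set ms) \<le> 15" using card_length[of ms] by (simp add: ms_def)
  then have "card (set ms) < DIM(real^4^4)" by simp
  then obtain B where B: "B \<noteq> 0" "\<And>M. M \<in> set ms \<Longrightarrow> inner B M = 0"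
    using exists_orthogonal[of "set ms"] by auto
  have "\<forall>i j. B $ i $ j = B $ j $ i"
    unfolding all_index4
    using B(2)[of "alt 0 1"] B(2)[of "alt 0 2"] B(2)[of "alt 0 3"] B(2)[of "alt 1 2"]
      B(2)[of "alt 1 3"] B(2)[of "alt 2 3"] by (simp add: ms_def alt)
  then have sym: "transpose B = B" by (simp add: transpose_def vec_eq_iff)
  have x2: "conj_form B (x 0) (x 2) = 0" "conj_form B (x 1) (x 3) = 0" "conj_form B (x 2) (x 4) = 0"
    "conj_form B (x 3) (x 5) = 0" "conj_form B (x 4) (x 0) = 0" "conj_form B (x 5) (x 1) = 0"
    and x3: "conj_form B (x 0) (x 3) = 0" "conj_form B (x 1) (x 4) = 0" "conj_form B (x 2) (x 5) = 0"
    by (simp_all add: outer[symmetric] B(2) ms_def)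
  have "\<forall>i. conj_form B (x i) (x (i + 2)) = 0 \<and> conj_form B (x i) (x (i + 3)) = 0"
    unfolding all_index6
    using x2 x3 conj_form_sym[OF sym, of "x 3" "x 0"] conj_form_sym[OF sym, of "x 4" "x 1"]
      conj_form_sym[OF sym, of "x 5" "x 2"]
    by (simp add: index6_wrap)
  then show ?thesis using B(1) sym by blast
qed

locale complex_hexagon =
  fixes x :: "6 \<Rightarrow> real^4"
  assumes gp: "general_position x" and edge: "sp (x i) (x (i + 1)) = 0"
    and nonzero: "x i \<noteq> 0"
begin

lemma span4: "distinct [i, j, k, l] \<Longrightarrow> span {x i, x j, x k, x l} = UNIV"
  using general_position_span gp by blast

lemma edge': "sp (x (i + 1)) (x i) = 0"
  using edge sp_commute_zero by blast

text \<open>Otherwise \<open>x i\<close> would be orthogonal to itself, both neighbours and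
  \<open>x (i + 2)\<close>, four vectors which span the space.\<close>

lemma nonperp_2: "sp (x (i + 2)) (x i) \<noteq> 0"
proof
  assume "sp (x (i + 2)) (x i) = 0"
  then have "sp (x i) (x (i + 2)) = 0" using sp_commute_zero by blast
  moreover have "sp (x i) (x (i - 1)) = 0" using edge'[of "i - 1"] by simp
  ultimately have "x i = 0"
    using sp_vanishes[OF span4[of "i - 1" i "i + 1" "i + 2"]] edge by (simp add: eq_diff_eq diff_eq_eq)
  then show False using nonzero by simp
qed

context
  fixes B
  assumes B_nonzero: "B \<noteq> 0" and B_sym: "transpose B = B"
    and B2: "conj_form B (x i) (x (i + 2)) = 0" and B3: "conj_form B (x i) (x (i + 3)) = 0"
begin

lemma B_zero:
  "conj_form B (x (i + 2)) (x i) = 0" "conj_form B (x (i + 3)) (x i) = 0"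
  "conj_form B (x (i + 4)) (x i) = 0"
proof -
  have eq: "i + 4 + 2 = i" by (simp add: add.assoc index6_wrap)
  show "conj_form B (x (i + 4)) (x i) = 0" using B2[of "i + 4"] by (simp only: eq)
qed (use B2 B3 conj_form_sym[OF B_sym] in metis)+

text \<open>The kernel would propagate around the hexagon: a vertex following one in the kernel is
  conjugate to that one and to three others, which together span. Four consecutive vertices in the
  kernel give \<open>B = 0\<close>.\<close>

lemma B_vertex_nonzero: "B *v x i \<noteq> 0"
proof
  assume 0: "B *v x i = 0"
  have step: "B *v x (j + 1) = 0" if "B *v x j = 0" for j
  proof (rule inner_vanishes[OF span4[of j "j + 3" "j + 4" "j + 5"]])
    show "distinct [j, j + 3, j + 4, j + 5]" by simp
    show "inner (x j) (B *v x (j + 1)) = 0"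
      using that conj_form_sym[OF B_sym, of "x j" "x (j + 1)"] by (simp add: conj_form_def)
    show "inner (x (j + 3)) (B *v x (j + 1)) = 0"
      using B_zero(1)[of "j + 1"] by (simp add: conj_form_def add.assoc)
    show "inner (x (j + 4)) (B *v x (j + 1)) = 0"
      using B_zero(2)[of "j + 1"] by (simp add: conj_form_def add.assoc)
    show "inner (x (j + 5)) (B *v x (j + 1)) = 0"
      using B_zero(3)[of "j + 1"] by (simp add: conj_form_def add.assoc)
  qed
  have 1: "B *v x (i + 1) = 0" using step 0 by blast
  have 2: "B *v x (i + 2) = 0" using step[OF 1] by (simp add: add.assoc)
  have 3: "B *v x (i + 3) = 0" using step[OF 2] by (simp add: add.assoc)
  have "B *v v = 0" for v
  proof -
    have "v \<in> span {x i, x (i + 1), x (i + 2), x (i + 3)}" using span4[of i "i + 1" "i + 2" "i + 3"] by simp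
    then show ?thesis
      using linear_eq_0_on_span[of "(*v) B" "{x i, x (i + 1), x (i + 2), x (i + 3)}" v] 0 1 2 3
      by (auto simp: matrix_vector_mul_linear)
  qed
  then have "B = 0" by (simp add: matrix_eq)
  then show False using B_nonzero by simp
qed

lemma B_edge_nonzero: "conj_form B (x (i + 1)) (x i) \<noteq> 0"
proof
  assume "conj_form B (x (i + 1)) (x i) = 0"
  then have "B *v x i = 0"
    using inner_vanishes[OF span4[of "i + 1" "i + 2" "i + 3" "i + 4"]] B_zero[of i]
    by (simp add: conj_form_def)
  then show False using B_vertex_nonzero by simp
qed

text \<open>Both linear forms vanish on \<open>x (i + 2)\<close>, \<open>x (i + 3)\<close> and
  \<open>x (i + 4)\<close>, so they agree up to the factor \<open>\<mu>\<close>, which is read off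
  at \<open>x (i + 1)\<close>. Geometrically, the correlation sends a vertex to the null plane of
  the opposite vertex.\<close>

lemma B_proportional: "\<exists>\<mu>. \<mu> \<noteq> 0 \<and> (\<forall>v. conj_form B v (x i) = \<mu> * sp (x (i + 3)) v)"
proof -
  have nz: "sp (x (i + 3)) (x (i + 1)) \<noteq> 0" using nonperp_2[of "i + 1"] by (simp add: add.assoc)
  define \<mu> where "\<mu> = conj_form B (x (i + 1)) (x i) / sp (x (i + 3)) (x (i + 1))"
  define f where "f v = conj_form B v (x i) - \<mu> * sp (x (i + 3)) v" for v
  have lin: "linear f"
    by (rule linearI) (simp_all add: f_def algebra_simps)
  have "sp (x (i + 3)) (x (i + 2)) = 0" "sp (x (i + 3)) (x (i + 4)) = 0"
    using edge'[of "i + 2"] edge[of "i + 3"] by (simp_all add: add.assoc)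
  then have f: "f (x (i + 1)) = 0" "f (x (i + 2)) = 0" "f (x (i + 3)) = 0" "f (x (i + 4)) = 0"
    using B_zero[of i] nz by (simp_all add: f_def \<mu>_def)
  have "distinct [i + 1, i + 2, i + 3, i + 4]" by simp
  then have "f v = 0" for v using linear_vanishes[OF lin span4 f] by blast
  then have "conj_form B v (x i) = \<mu> * sp (x (i + 3)) v" for v by (simp add: f_def)
  moreover have "\<mu> \<noteq> 0" using nz B_edge_nonzero by (simp add: \<mu>_def)
  ultimately show ?thesis by blast
qed

lemma B_invertible: "invertible B"
proof -
  have "v = 0" if v: "B *v v = 0" for v
  proof -
    have "sp (x (i + 3)) v = 0" for i
    proof -
      obtain \<mu> where "\<mu> \<noteq> 0" "conj_form B v (x i) = \<mu> * sp (x (i + 3)) v"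
        using B_proportional by blast
      moreover have "conj_form B v (x i) = 0"
        using conj_form_sym[OF B_sym, of v "x i"] v by (simp add: conj_form_def)
      ultimately show ?thesis by simp
    qed
    then have "sp v (x (i + 3)) = 0" for i using sp_commute_zero by blast
    \<comment> \<open>These values of the index shift to the vertices 0, 1, 2, 3.\<close>
    from this[of "- 3"] this[of "- 2"] this[of "- 1"] this[of 0]
    show ?thesis using sp_vanishes[OF span4[of 0 1 2 3], of v] by simp
  qed
  then show ?thesis
    by (simp add: invertible_left_inverse matrix_left_invertible_ker)
qed

lemma B_associated: "associated_correlation B x"
  unfolding associated_correlation_def
proof (intro conjI allI B_sym B_invertible)
  fix i
  have plane: "hexagon_plane x (i + 3) = span {x (i + 2), x (i + 3), x (i + 4)}"
  proof -
    have "i + 3 - 1 = i + 2" "i + 3 + 1 = i + 4" by (simp_all add: add.assoc algebra_simps)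
    then show ?thesis by (simp only: hexagon_plane_def)
  qed
  have sub: "subspace (correlation_image B (x i))"
    by (auto simp: subspace_def correlation_image_def inner_add_left)
  have ci: "v \<in> correlation_image B (x i) \<longleftrightarrow> conj_form B v (x i) = 0" for v
    by (simp add: correlation_image_def conj_form_def)
  show "correlation_image B (x i) = hexagon_plane x (i + 3)"
  proof
    show "hexagon_plane x (i + 3) \<subseteq> correlation_image B (x i)"
      unfolding plane by (rule span_minimal[OF _ sub]) (simp add: ci B_zero)
    show "correlation_image B (x i) \<subseteq> hexagon_plane x (i + 3)"
    proof
      fix v assume v: "v \<in> correlation_image B (x i)"
      have "v \<in> span (insert (x (i + 1)) {x (i + 2), x (i + 3), x (i + 4)})"
        using span4[of "i + 1" "i + 2" "i + 3" "i + 4"] by simp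
      then obtain k where k: "v - k *\<^sub>R x (i + 1) \<in> span {x (i + 2), x (i + 3), x (i + 4)}"
        using span_breakdown_eq by blast
      then have "v - k *\<^sub>R x (i + 1) \<in> correlation_image B (x i)"
        using span_minimal[OF _ sub, of "{x (i + 2), x (i + 3), x (i + 4)}"] by (auto simp: ci B_zero)
      then have "k = 0" using v B_edge_nonzero by (simp add: ci)
      then show "v \<in> hexagon_plane x (i + 3)" using k by (simp add: plane)
    qed
  qed
qed

end

end

lemma dim_span_nonparallel:
  assumes "nonparallel a b"
  shows "dim (span {a, b}) = 2"
proof -
  have "b \<notin> span {a}"
  proof
    assume "b \<in> span {a}"
    then obtain k where "1 *\<^sub>R b = k *\<^sub>R a" by (auto simp: span_singleton)
    then show False using nonparallel_eqD[OF assms, of k 1] by simp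
  qed
  moreover have "a \<noteq> 0" using nonparallel_nonzero assms by blast
  ultimately have "independent {b, a}" "b \<noteq> a"
    using span_base[of a "{a}"] by (auto simp: independent_insert)
  then have "dim {b, a} = 2" using dim_eq_card_independent[of "{b, a}"] by simp
  then show ?thesis by (simp add: insert_commute)
qed

text \<open>The image is the orthogonal complement of \<open>B *v a\<close> and
  \<open>B *v b\<close>. It is two-dimensional because \<open>B\<close> is invertible, and it
  contains the plane of \<open>c\<close> and \<open>d\<close>.\<close>

lemma correlation_line_image_eq:
  assumes "invertible B" "nonparallel a b" "nonparallel c d"
    and "conj_form B c a = 0" "conj_form B c b = 0" "conj_form B d a = 0" "conj_form B d b = 0"
  shows "correlation_line_image B (span {a, b}) = span {c, d}"
proof -
  have B: "v = 0" if "B *v v = 0" for v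
    using assms(1) that by (simp add: invertible_left_inverse matrix_left_invertible_ker)
  have np: "nonparallel (B *v a) (B *v b)"
    unfolding nonparallel_def
  proof (intro allI impI)
    fix s t assume "s *\<^sub>R (B *v a) + t *\<^sub>R (B *v b) = 0"
    then have "B *v (s *\<^sub>R a + t *\<^sub>R b) = 0"
      by (simp add: matrix_vector_right_distrib matrix_vector_mult_scaleR)
    then show "s = 0 \<and> t = 0" using B nonparallelD[OF assms(2)] by blast
  qed
  define K where "K = {y \<in> UNIV. \<forall>u \<in> span {B *v a, B *v b}. orthogonal u y}"
  have "dim K + dim (span {B *v a, B *v b}) = dim (UNIV :: (real^4) set)"
    unfolding K_def by (rule dim_subspace_orthogonal_to_vectors) simp_all
  then have dK: "dim K = 2" using dim_span_nonparallel[OF np] by simp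
  have Kiff: "y \<in> K \<longleftrightarrow> conj_form B y a = 0 \<and> conj_form B y b = 0" for y
  proof
    assume "y \<in> K"
    then have "orthogonal (B *v a) y" "orthogonal (B *v b) y"
      unfolding K_def using pair_in_span by blast+
    then show "conj_form B y a = 0 \<and> conj_form B y b = 0"
      by (simp add: conj_form_def orthogonal_def inner_commute)
  next
    assume "conj_form B y a = 0 \<and> conj_form B y b = 0"
    then show "y \<in> K"
      by (auto simp: K_def span_pair_iff conj_form_def orthogonal_def inner_commute inner_add_right)
  qed
  have "subspace K" unfolding subspace_def by (simp add: Kiff)
  moreover have "span {c, d} \<subseteq> K" using assms(4-) by (auto simp: span_pair_iff Kiff)
  ultimately have "span {c, d} = K"
    using subspace_dim_equal[of "span {c, d}" K] dK dim_span_nonparallel[OF assms(3)] by simp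
  moreover have "correlation_line_image B (span {a, b}) = K"
  proof (intro set_eqI iffI)
    fix y assume "y \<in> correlation_line_image B (span {a, b})"
    then show "y \<in> K"
      using pair_in_span(1)[of a b] pair_in_span(2)[of b a] by (auto simp: correlation_line_image_def correlation_image_def Kiff conj_form_def)
  next
    fix y assume "y \<in> K"
    then have "conj_form B y v = 0" if "v \<in> span {a, b}" for v
      using that by (auto simp: Kiff span_pair_iff)
    then show "y \<in> correlation_line_image B (span {a, b})"
      by (auto simp: correlation_line_image_def correlation_image_def conj_form_def)
  qed
  ultimately show ?thesis by simp
qed

section \<open>Correlated circles\<close>

context cube_points
begin

text \<open>In the labelling by \<open>Y\<close>, the vertices \<open>Y l m\<close> and
  \<open>Y l n\<close> are opposite, while \<open>Y l m\<close> and \<open>Y m n\<close> are two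
  steps apart.\<close>

context
  fixes B :: "real^4^4"
  assumes B_sym: "transpose B = B"
    and B2: "distinct [l, m, n] \<Longrightarrow> conj_form B (Y l m) (Y m n) = 0"
    and B3: "distinct [l, m, n] \<Longrightarrow> conj_form B (Y l m) (Y l n) = 0"
    and B_polar: "distinct [l, m, n] \<Longrightarrow> \<exists>\<mu>. \<forall>v. conj_form B v (Y l m) = \<mu> * sp (Y l n) v"
begin

text \<open>Every vertex of a side is two or three steps away from every vertex of the opposite
  side.\<close>

lemma conj_opposite:
  assumes d: "distinct [l, m, n]" and u: "u \<in> ln (cl l)" and v: "v \<in> ln (clm m n)"
  shows "conj_form B u v = 0"
proof -
  have d': "distinct [m, l, n]" "distinct [n, m, l]" "distinct [m, n, l]" "distinct [n, l, m]"
    using d by auto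
  obtain s t where "u = s *\<^sub>R Y m l + t *\<^sub>R Y n l"
    using u cl_span[OF d'(1)] span_pair_iff by blast
  moreover obtain s' t' where "v = s' *\<^sub>R Y m n + t' *\<^sub>R Y n m"
    using v clm_span[of m n] d span_pair_iff by auto
  moreover have "conj_form B (Y m l) (Y m n) = 0" "conj_form B (Y n l) (Y n m) = 0"
    using B3[OF d'(1)] B3[OF d'(4)] .
  moreover have "conj_form B (Y m l) (Y n m) = 0" "conj_form B (Y n l) (Y m n) = 0"
    using B2[OF d'(2)] B2[OF d'(3)] conj_form_sym[OF B_sym, of "Y m l" "Y n m"]
      conj_form_sym[OF B_sym, of "Y n l" "Y m n"] by simp_all
  ultimately show ?thesis by simp
qed

text \<open>The two expressions of \<open>D l\<close> in its turbines yield \<open>C l\<close> as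
  well: their difference, sorted in another way, lies on the lines of both \<open>c\<close> and
  \<open>c\<^sub>l\<close>. After the conjugate pairs of vertices are removed, a single term
  remains, which \<open>B_polar\<close> turns into a value of \<open>sp\<close>.\<close>

lemma conj_CD: "conj_form B (C l) (D l) = 0"
proof -
  obtain m n where d: "distinct [l, m, n]" using other_indices by blast
  note ne = distinct3D[OF d]
  have d': "distinct [m, l, n]" "distinct [n, l, m]" "distinct [n, m, l]" "distinct [l, m, n]"
    using d by auto
  obtain p s where D: "D l = p *\<^sub>R C m + s *\<^sub>R Y m l"
    using D_in_turbine[of m l] ne span_pair_iff by auto
  obtain p' t where D': "D l = p' *\<^sub>R C n + t *\<^sub>R Y n l"
    using D_in_turbine[of n l] ne span_pair_iff by auto
  obtain g h where Cm: "C m = g *\<^sub>R Y l m + h *\<^sub>R Y n m"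
    using C(3)[of m] cl_span[OF d] span_pair_iff by metis
  \<comment> \<open>One form of \<open>u\<close> uses vertices of \<open>c\<^sub>l\<close> and the
    other contact points of \<open>c\<close>, so \<open>u\<close> is proportional to
    \<open>C l\<close>.\<close>
  define u where "u = t *\<^sub>R Y n l - s *\<^sub>R Y m l"
  have u: "u = p *\<^sub>R C m - p' *\<^sub>R C n" using D D' by (simp add: u_def algebra_simps)
  have "u \<noteq> 0"
  proof
    assume u0: "u = 0"
    have "nonparallel (C m) (C n)" using nonparallel_C ne by simp
    then have "p = 0" using u0 u nonparallel_eqD[of "C m" "C n" p p'] by simp
    have "nonparallel (Y n l) (Y m l)" using nonparallel_Y_cl[OF d'(2)] .
    then have "s = 0" using u0 nonparallel_eqD[of "Y n l" "Y m l" t s] by (simp add: u_def)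
    then show False using D D_nonzero[of l] \<open>p = 0\<close> by simp
  qed
  have "u \<in> ln (cl l)"
    unfolding u_def cl_span[OF d'(2)] by (simp add: pair_in_span span_diff span_scale)
  moreover have "u \<in> ln c"
    unfolding u using c_span[of m n] ne by (simp add: pair_in_span span_diff span_scale)
  ultimately have "u \<in> span {C l}" using generated_C unfolding generated_by_def by blast
  then have "C l \<in> span {u}" using span_singleton_commute \<open>u \<noteq> 0\<close> by blast
  then obtain k where k: "C l = k *\<^sub>R u" by (auto simp: span_singleton)
  obtain \<mu> where lam: "\<And>v. conj_form B v (Y m l) = \<mu> * sp (Y m n) v"
    using B_polar[OF d'(1)] by blast
  have z: "conj_form B (Y n l) (Y l m) = 0" "conj_form B (Y n l) (Y n m) = 0"
    "conj_form B (Y m l) (Y n m) = 0"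
    using B2[OF d'(2)] B3[OF d'(2)] B2[OF d'(3)] conj_form_sym[OF B_sym, of "Y m l" "Y n m"]
    by simp_all
  \<comment> \<open>The only surviving term of \<open>conj_form B u (C m)\<close> pairs
    \<open>Y m l\<close> with \<open>Y l m\<close>; by symmetry it is absorbed into the pairing of
    \<open>u\<close> with \<open>Y m l\<close>.\<close>
  define w where "w = u - (p * g) *\<^sub>R Y l m"
  have "conj_form B u (D l) = s * conj_form B w (Y m l)"
    using z conj_form_sym[OF B_sym, of "Y m l" "Y l m"]
    by (simp add: D Cm u_def w_def algebra_simps)
  also have "\<dots> = s * (\<mu> * sp (Y m n) w)" by (simp add: lam)
  also have "w = (p * h) *\<^sub>R Y n m - p' *\<^sub>R C n"
    by (simp add: w_def u Cm algebra_simps)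
  also have "sp (Y m n) ((p * h) *\<^sub>R Y n m - p' *\<^sub>R C n) = 0"
    using perp_YY_clm[of m n] perp_CY[of m n] sp_commute_zero[of "C n" "Y m n"] ne by simp
  finally show ?thesis by (simp add: k)
qed

text \<open>\<open>E l m n\<close> lies on the side opposite to \<open>c\<^sub>l\<close>.
  \<open>E m l n\<close> does not, but it is a combination of \<open>Y m n\<close>, which does, and
  \<open>D l\<close>, which \<open>conj_CD\<close> covers.\<close>

lemma conj_CE:
  assumes d: "distinct [l, m, n]"
  shows "conj_form B (C l) (E l m n) = 0" "conj_form B (C l) (E m l n) = 0"
proof -
  show "conj_form B (C l) (E l m n) = 0" using conj_opposite[OF d] C(3) E_clm[OF d] by blast
  have "distinct [m, l, n]" using d by auto
  then obtain s t where "E m l n = s *\<^sub>R Y m n + t *\<^sub>R D l" using E_in_turbine span_pair_iff by metis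
  moreover have "Y m n \<in> ln (clm m n)" using Y(3) d by simp
  then have "conj_form B (C l) (Y m n) = 0" using conj_opposite[OF d] C(3) by blast
  ultimately show "conj_form B (C l) (E m l n) = 0" using conj_CD by simp
qed

lemma correlation_lines:
  assumes inv: "invertible B" and L: "lie_construction \<Phi> c cl clm C Y D E c123"
  shows "correlation_line_image B (ln c) = ln c123" "correlation_line_image B (ln c123) = ln c"
proof -
  note V = lie_constructionD(5,6)[OF L]
  have "same_circle c123 c123" unfolding same_circle_def by (intro exI[of _ 1]) simp
  then have "distinct [l, m, n] \<Longrightarrow> E l m n \<in> ln c123" for l m n
    using V(2)[of c123] unfolding contact_element_def by blast
  then have E12: "E 1 2 3 \<in> ln c123" "E 2 1 3 \<in> ln c123" by simp_all
  have np: "nonparallel (E 1 2 3) (E 2 1 3)" "nonparallel (C 1) (C 2)"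
    using nonparallel_E[of 1 2 3] nonparallel_C[of 1 2] by simp_all
  have lines: "ln c = span {C 1, C 2}" "ln c123 = span {E 1 2 3, E 2 1 3}"
    using c_span[of 1 2] lagrangian_eq_span[OF lagrangian_circle[OF V(1)] np(1) E12] by simp_all
  have z: "conj_form B (C 1) (E 1 2 3) = 0" "conj_form B (C 1) (E 2 1 3) = 0"
    "conj_form B (C 2) (E 2 1 3) = 0" "conj_form B (C 2) (E 1 2 3) = 0"
    using conj_CE[of 1 2 3] conj_CE[of 2 1 3] by simp_all
  then have z': "conj_form B (E 1 2 3) (C 1) = 0" "conj_form B (E 2 1 3) (C 1) = 0"
    "conj_form B (E 2 1 3) (C 2) = 0" "conj_form B (E 1 2 3) (C 2) = 0"
    using conj_form_sym[OF B_sym] by metis+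
  show "correlation_line_image B (ln c) = ln c123"
    unfolding lines using correlation_line_image_eq[OF inv np(2,1)] z' by blast
  show "correlation_line_image B (ln c123) = ln c"
    unfolding lines using correlation_line_image_eq[OF inv np] z by blast
qed

end

end

section \<open>The hexagon vertices as contact points\<close>

text \<open>\<open>vertex_index l m\<close> is the index of the common point of the lines of \<open>c\<^sub>m\<close> and \<open>c\<^sub>l\<^sub>m\<close>.\<close>

definition vertex_index :: "3 \<Rightarrow> 3 \<Rightarrow> 6" where
  "vertex_index l m =
     (if m = 1 then (if l = 2 then 1 else 0)
      else if m = 2 then (if l = 1 then 2 else 3)
      else (if l = 2 then 4 else 5))"

lemma vertex_index_inj:
  "l \<noteq> m \<Longrightarrow> l' \<noteq> m' \<Longrightarrow> vertex_index l m = vertex_index l' m' \<longleftrightarrow> l = l' \<and> m = m'"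
  using exhaust_3[of l] exhaust_3[of m] exhaust_3[of l'] exhaust_3[of m']
  by (elim disjE; simp add: vertex_index_def)

lemma vertex_index_shift:
  assumes "distinct [l, m, n]"
  shows "vertex_index l n = vertex_index l m + 3"
    and "vertex_index m n = vertex_index l m + 2 \<or> vertex_index m n = vertex_index l m + 4"
  using assms exhaust_3[of l] exhaust_3[of m] exhaust_3[of n]
  by (elim disjE; simp add: vertex_index_def)+

lemma circle_hexagon_numeral [simp]:
  "circle_hexagon cl clm 0 = clm 1 3" "circle_hexagon cl clm 1 = cl 1"
  "circle_hexagon cl clm 2 = clm 1 2" "circle_hexagon cl clm 3 = cl 2"
  "circle_hexagon cl clm 4 = clm 2 3" "circle_hexagon cl clm 5 = cl 3"
  by (simp_all add: circle_hexagon_def)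

context lie_model
begin

lemma vertex_on_lines:
  assumes h: "touching_hexagon cl clm" and v: "hexagon_vertices \<Phi> (circle_hexagon cl clm) x"
    and "l \<noteq> m"
  shows "x (vertex_index l m) \<in> ln (cl m)" "x (vertex_index l m) \<in> ln (clm l m)"
proof -
  have "x i \<in> ln (circle_hexagon cl clm i)" "x i \<in> ln (circle_hexagon cl clm (i + 1))" for i
    using v unfolding hexagon_vertices_def by blast+
  from this(1)[of 0] this(2)[of 0] this(1)[of 1] this(2)[of 1] this(1)[of 2] this(2)[of 2]
    this(1)[of 3] this(2)[of 3] this(1)[of 4] this(2)[of 4] this(1)[of 5] this(2)[of 5]
  have x: "x 0 \<in> ln (clm 1 3)" "x 0 \<in> ln (cl 1)" "x 1 \<in> ln (cl 1)" "x 1 \<in> ln (clm 1 2)"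
    "x 2 \<in> ln (clm 1 2)" "x 2 \<in> ln (cl 2)" "x 3 \<in> ln (cl 2)" "x 3 \<in> ln (clm 2 3)"
    "x 4 \<in> ln (clm 2 3)" "x 4 \<in> ln (cl 3)" "x 5 \<in> ln (cl 3)" "x 5 \<in> ln (clm 1 3)"
    by (simp_all add: index6_wrap)
  have c: "clm 2 1 = clm 1 2" "clm 3 1 = clm 1 3" "clm 3 2 = clm 2 3"
    using h unfolding touching_hexagon_def by simp_all
  show "x (vertex_index l m) \<in> ln (cl m)" "x (vertex_index l m) \<in> ln (clm l m)"
    using assms(3) exhaust_3[of l] exhaust_3[of m] x c
    by (elim disjE; simp add: vertex_index_def)+
qed

lemma oriented_circle_hexagon:
  assumes "touching_hexagon cl clm"
  shows "oriented_circle (circle_hexagon cl clm i)"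
proof -
  have "\<forall>i. oriented_circle (circle_hexagon cl clm i)"
    unfolding all_index6 using assms unfolding touching_hexagon_def by simp
  then show ?thesis by blast
qed

lemma complex_hexagon_vertices:
  assumes h: "touching_hexagon cl clm" and v: "hexagon_vertices \<Phi> (circle_hexagon cl clm) x"
    and g: "general_position x"
  shows "complex_hexagon x"
proof
  fix i
  have "x i \<in> ln (circle_hexagon cl clm (i + 1))" "x (i + 1) \<in> ln (circle_hexagon cl clm (i + 1))"
    using v unfolding hexagon_vertices_def by blast+
  then show "sp (x i) (x (i + 1)) = 0"
    using lagrangian_isotropic lagrangian_circle oriented_circle_hexagon[OF h] by blast
  show "x i \<noteq> 0" using v unfolding hexagon_vertices_def by blast
qed (rule g)

text \<open>A common point of two non-adjacent sides is orthogonal to the vertices on both. These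
  are four different vertices, which span the space by general position, so the point is
  zero.\<close>

lemma generic_hexagon_vertices:
  assumes h: "touching_hexagon cl clm" and v: "hexagon_vertices \<Phi> (circle_hexagon cl clm) x"
    and g: "general_position x"
  shows "generic_hexagon cl clm"
proof -
  interpret complex_hexagon x using complex_hexagon_vertices assms .
  define Y where "Y l m = x (vertex_index l m)" for l m
  have o: "oriented_circle (cl l)" "l \<noteq> m \<Longrightarrow> oriented_circle (clm l m)"
    "l \<noteq> m \<Longrightarrow> clm m l = clm l m" for l m
    using h unfolding touching_hexagon_def by metis+
  have Y: "l \<noteq> m \<Longrightarrow> Y l m \<in> ln (cl m)" "l \<noteq> m \<Longrightarrow> Y l m \<in> ln (clm l m)"
    "l \<noteq> m \<Longrightarrow> Y l m \<in> ln (clm m l)" "Y l m \<noteq> 0" for l m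
    using vertex_on_lines[OF h v, of l m] o(3)[of l m] nonzero by (simp_all add: Y_def)
  have perp_cl: "sp u (Y l m) = 0" if "u \<in> ln (cl m)" "l \<noteq> m" for u l m
    using lagrangian_isotropic[OF lagrangian_circle[OF o(1)]] that Y(1) by blast
  have perp_clm: "sp u (Y l m) = 0" "sp u (Y m l) = 0" if "u \<in> ln (clm l m)" "l \<noteq> m" for u l m
    using lagrangian_isotropic[OF lagrangian_circle[OF o(2)]] that Y(2)[of l m] Y(3)[of m l] by auto
  have vanish: "u = 0" if "sp u (Y l m) = 0" "sp u (Y l' m') = 0" "sp u (Y l'' m'') = 0"
    "sp u (Y l''' m''') = 0" "distinct [(l, m), (l', m'), (l'', m''), (l''', m''')]"
    "l \<noteq> m" "l' \<noteq> m'" "l'' \<noteq> m''" "l''' \<noteq> m'''" for u l m l' m' l'' m'' l''' m'''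
  proof (rule sp_vanishes[OF span4])
    show "distinct [vertex_index l m, vertex_index l' m', vertex_index l'' m'', vertex_index l''' m''']"
      using that by (simp add: vertex_index_inj)
  qed (use that in \<open>simp_all add: Y_def\<close>)
  have cc: "u = 0" if "distinct [l, m, n]" "u \<in> ln (clm l m)" "u \<in> ln (clm m n)" for u l m n
    using vanish[of u l m m l m n n m] perp_clm[of u l m] perp_clm[of u m n] that by auto
  show ?thesis
    unfolding generic_hexagon_def
  proof (intro conjI allI impI h)
    fix l m n :: 3 assume d: "distinct [l, m, n]"
    note ne = distinct3D[OF d]
    show "\<not> touch (cl l) (cl m)"
    proof
      assume "touch (cl l) (cl m)"
      then obtain u where u: "u \<noteq> 0" "u \<in> ln (cl l)" "u \<in> ln (cl m)"
        using touching_circles_meet o(1) by blast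
      then show False
        using vanish[of u m l n l l m n m] perp_cl[of u l m] perp_cl[of u l n]
          perp_cl[of u m l] perp_cl[of u m n] ne by auto
    qed
    show "\<not> touch (clm l m) (clm m n)"
    proof
      assume "touch (clm l m) (clm m n)"
      then obtain u where "u \<noteq> 0" "u \<in> ln (clm l m)" "u \<in> ln (clm m n)"
        using touching_circles_meet o(2) ne by metis
      then show False using cc d by blast
    qed
    show "\<not> touch (cl l) (clm m n)"
    proof
      assume "touch (cl l) (clm m n)"
      then obtain u where u: "u \<noteq> 0" "u \<in> ln (cl l)" "u \<in> ln (clm m n)"
        using touching_circles_meet o ne by metis
      then show False
        using vanish[of u m l n l m n n m] perp_cl[of u l m] perp_cl[of u l n] perp_clm[of u m n] ne
        by auto
    qed
  qed
qed

end

theorem theorem4p11: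
  fixes \<Phi> :: "lvec \<Rightarrow> lvec" and c :: lvec and cl :: "3 \<Rightarrow> lvec" and clm :: "3 \<Rightarrow> 3 \<Rightarrow> lvec"
  assumes "lie_identification \<Phi>"
    and "touching_hexagon cl clm"
    and "hexagon_in_general_position \<Phi> (circle_hexagon cl clm)"
    and "oriented_circle c" and "\<And>l. touch c (cl l)"
    and "\<exists>V. oriented_circle V \<and> (\<forall>l m. l \<noteq> m \<longrightarrow> touch V (clm l m))"
  shows "\<exists>c123. constructed \<Phi> c cl clm c123 \<and>
           (\<forall>l m. l \<noteq> m \<longrightarrow> touch c123 (clm l m)) \<and>
           lie_well_defined \<Phi> c cl clm c123 \<and>
           correlated \<Phi> c cl clm c123"
proof -
  interpret lie_model \<Phi> by unfold_locales (rule assms(1))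
  obtain x where v: "hexagon_vertices \<Phi> (circle_hexagon cl clm) x" and gp: "general_position x"
    using assms(3) unfolding hexagon_in_general_position_def by blast
  have g: "generic_hexagon cl clm" using generic_hexagon_vertices[OF assms(2) v gp] .
  interpret X: complex_hexagon x using complex_hexagon_vertices[OF assms(2) v gp] .
  define Y where "Y l m = x (vertex_index l m)" for l m
  \<comment> \<open>Only \<open>C\<close> is kept from this choice: on the hexagon the contact
    points must be the vertices \<open>x\<close>, to which the correlation refers.\<close>
  obtain C Y' where "cube_contacts \<Phi> c cl clm C Y'"
    using exists_cube_contacts[OF g assms(4,5)] by blast
  then interpret C': cube_contacts \<Phi> c cl clm C Y' .
  have "cube_contacts \<Phi> c cl clm C Y"
    by unfold_locales (use g assms(4,5) C'.C vertex_on_lines[OF assms(2) v] X.nonzero in \<open>simp_all add: Y_def\<close>)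
  then obtain D E c123 where P: "cube_points \<Phi> c cl clm C Y D E"
    and L: "lie_construction \<Phi> c cl clm C Y D E c123" and K: "constructed \<Phi> c cl clm c123"
    using cube_contacts.exists_constructed by blast
  interpret cube_points \<Phi> c cl clm C Y D E by (rule P)
  have opp: "oriented_circle c123" "\<And>l m. l \<noteq> m \<Longrightarrow> touch c123 (clm l m)"
    using lie_opposite_construction[OF L] unfolding lie_opposite_def by blast+
  obtain B where B: "B \<noteq> 0" "transpose B = B" "\<And>i. conj_form B (x i) (x (i + 2)) = 0"
    "\<And>i. conj_form B (x i) (x (i + 3)) = 0"
    using exists_conj_form[of x] by blast
  note assoc = X.B_associated[OF B] and zero = X.B_zero[OF B] and polar = X.B_proportional[OF B]
  have inv: "invertible B" using assoc unfolding associated_correlation_def by blast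
  have Y2: "conj_form B (Y l m) (Y m n) = 0" if "distinct [l, m, n]" for l m n
    using vertex_index_shift(2)[OF that] zero(1,3)[of "vertex_index l m"]
      conj_form_sym[OF B(2), of "Y l m" "Y m n"] by (auto simp: Y_def)
  have Y3: "conj_form B (Y l m) (Y l n) = 0" if "distinct [l, m, n]" for l m n
    using vertex_index_shift(1)[OF that] B(4) by (simp add: Y_def)
  have Yp: "\<exists>\<mu>. \<forall>v. conj_form B v (Y l m) = \<mu> * sp (Y l n) v" if "distinct [l, m, n]" for l m n
    using vertex_index_shift(1)[OF that] polar[of "vertex_index l m"] by (auto simp: Y_def)
  have "touching_cube c cl clm c123"
    unfolding touching_cube_def using assms(2,4,5) opp by blast
  then have "correlated \<Phi> c cl clm c123"
    unfolding correlated_def using v gp assoc correlation_lines[OF B(2) Y2 Y3 Yp inv L] by blast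
  moreover have "lie_well_defined \<Phi> c cl clm c123"
    using lie_well_defined_construction[OF g assms(4,5) K] .
  ultimately show ?thesis using K opp(2) by blast
qed

end
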